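(* Let $k\geq 2$ be an integer and let $a\in\mathbb{R}$ satisfy $a^2(1+k^2)<2$. Then the steady state $\psi_\ast=\sin(kx_1)$, $\Phi_\ast=a\sin(kx_1)$ of the inertial MHD system on $\mathbb{T}^2$ is linearly unstable. More precisely, its linearization has a nonzero smooth eigenfunction in the transverse Fourier mode $e^{\mathrm{i}x_2}$ with a positive real eigenvalue: there are $\lambda>0$ and $(h,f)\in C^\infty(\mathbb{R}/2\pi\mathbb{Z};\mathbb{C}^2)$, $(h,f)\neq 0$, such that $(\omega,F)(t,x)=e^{\lambda t}e^{\mathrm{i}x_2}(h(x_1),f(x_1))$ solves the linearized system around this steady state.
   Context: Let $\mathbb{T}^2=(\mathbb{R}/2\pi\mathbb{Z})^2$ and $\nabla^\perp f=(-\partial_{x_2}f,\partial_{x_1}f)$. The inertial MHD system is $$\partial_t\omega+\nabla^\perp\psi\cdot\nabla\omega+\nabla^\perp\Phi\cdot\nabla F=0,\quad \partial_tF+\nabla^\perp\psi\cdot\nabla F=0,\quad \Delta\psi=\omega,\quad (1-\Delta)\Phi=F .$$ The steady state has $\omega_\ast=\Delta\psi_\ast$, $F_\ast=(1-\Delta)\Phi_\ast$. With $u_\ast=\nabla^\perp\psi_\ast=(0,k\cos(kx_1))$, the linearized system for the perturbation $(\omega,F)$ ($\omega$ of mean zero) is $$\partial_t\omega+u_\ast\cdot\nabla\big[(1+k^2\Delta^{-1})\omega+a\{1-(1+k^2)(1-\Delta)^{-1}\}F\big]=0,$$ $$\partial_tF+u_\ast\cdot\nabla\big[F-a(1+k^2)\Delta^{-1}\omega\big]=0.$$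 *)

theory Defs
  imports "HOL-Analysis.Analysis"
begin

text \<open>
  Functions on the circle \<open>\<real>/2\<pi>\<int>\<close> and on the torus \<open>(\<real>/2\<pi>\<int>)^2\<close> are represented by
  \<open>2\<pi>\<close>-periodic functions on \<^typ>\<open>real\<close> and on \<^typ>\<open>real \<times> real\<close>.  Everything is polymorphic in the
  codomain: steady states and solutions of the nonlinear system are real-valued, perturbations are
  complex-valued.
\<close>

definition circle_smooth :: "(real \<Rightarrow> 'a::real_normed_vector) \<Rightarrow> bool" where
  "circle_smooth h \<longleftrightarrow>
     (\<forall>s. h (s + 2 * pi) = h s) \<and>
     (\<forall>n s. ((\<lambda>g r. vector_derivative g (at r)) ^^ n) h differentiable (at s))"

definition pd1 :: "(real \<times> real \<Rightarrow> 'a::real_normed_vector) \<Rightarrow> real \<times> real \<Rightarrow> 'a" where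
  "pd1 f x = vector_derivative (\<lambda>s. f (s, snd x)) (at (fst x))"

definition pd2 :: "(real \<times> real \<Rightarrow> 'a::real_normed_vector) \<Rightarrow> real \<times> real \<Rightarrow> 'a" where
  "pd2 f x = vector_derivative (\<lambda>s. f (fst x, s)) (at (snd x))"

text \<open>
  Smoothness: each iterated partial derivative, the word \<open>ds\<close> listing the successive directions
  (\<^const>\<open>True\<close> for \<open>x\<^sub>1\<close>, \<^const>\<open>False\<close> for \<open>x\<^sub>2\<close>), is (Frechet) differentiable everywhere.
\<close>

definition torus_smooth :: "(real \<times> real \<Rightarrow> 'a::real_normed_vector) \<Rightarrow> bool" where
  "torus_smooth f \<longleftrightarrow>
     (\<forall>x. f (fst x + 2 * pi, snd x) = f x \<and> f (fst x, snd x + 2 * pi) = f x) \<and>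
     (\<forall>ds x. foldr (\<lambda>d. if d then pd1 else pd2) ds f differentiable (at x))"

definition mean_zero :: "(real \<times> real \<Rightarrow> complex) \<Rightarrow> bool" where
  "mean_zero f \<longleftrightarrow> integral (cbox (0, 0) (2 * pi, 2 * pi)) f = 0"

definition laplace :: "(real \<times> real \<Rightarrow> 'a::real_normed_vector) \<Rightarrow> real \<times> real \<Rightarrow> 'a" where
  "laplace f x = pd1 (pd1 f) x + pd2 (pd2 f) x"

definition perp_grad :: "(real \<times> real \<Rightarrow> real) \<Rightarrow> real \<times> real \<Rightarrow> real \<times> real" where
  "perp_grad f x = (- pd2 f x, pd1 f x)"

definition advect ::
    "(real \<times> real \<Rightarrow> real \<times> real) \<Rightarrow> (real \<times> real \<Rightarrow> 'a::real_normed_vector) \<Rightarrow> real \<times> real \<Rightarrow> 'a" where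
  "advect u g x = fst (u x) *\<^sub>R pd1 g x + snd (u x) *\<^sub>R pd2 g x"

text \<open>
  On a smooth function \<open>w\<close> of mean zero, \<open>inv_laplace w\<close> is the unique smooth periodic function of
  mean zero with Laplacian \<open>w\<close>; it is unspecified elsewhere.  The operator \<open>1 - \<Delta>\<close> is
  invertible on all smooth periodic functions.
\<close>

definition inv_laplace :: "(real \<times> real \<Rightarrow> complex) \<Rightarrow> real \<times> real \<Rightarrow> complex" where
  "inv_laplace w = (THE p. torus_smooth p \<and> mean_zero p \<and> laplace p = w)"

definition inv_helmholtz :: "(real \<times> real \<Rightarrow> complex) \<Rightarrow> real \<times> real \<Rightarrow> complex" where
  "inv_helmholtz g = (THE p. torus_smooth p \<and> (\<lambda>x. p x - laplace p x) = g)"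

definition imhd_solution ::
    "(real \<Rightarrow> real \<times> real \<Rightarrow> real) \<Rightarrow> (real \<Rightarrow> real \<times> real \<Rightarrow> real) \<Rightarrow>
     (real \<Rightarrow> real \<times> real \<Rightarrow> real) \<Rightarrow> (real \<Rightarrow> real \<times> real \<Rightarrow> real) \<Rightarrow> bool" where
  "imhd_solution \<omega> F \<psi> \<Phi> \<longleftrightarrow>
     (\<forall>t. torus_smooth (\<omega> t) \<and> torus_smooth (F t) \<and> torus_smooth (\<psi> t) \<and> torus_smooth (\<Phi> t)) \<and>
     (\<forall>t x. laplace (\<psi> t) x = \<omega> t x) \<and>
     (\<forall>t x. \<Phi> t x - laplace (\<Phi> t) x = F t x) \<and>
     (\<forall>t x. ((\<lambda>s. \<omega> s x) has_vector_derivative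
        - (advect (perp_grad (\<psi> t)) (\<omega> t) x + advect (perp_grad (\<Phi> t)) (F t) x)) (at t)) \<and>
     (\<forall>t x. ((\<lambda>s. F s x) has_vector_derivative
        - advect (perp_grad (\<psi> t)) (F t) x) (at t))"

definition imhd_steady_state :: "(real \<times> real \<Rightarrow> real) \<Rightarrow> (real \<times> real \<Rightarrow> real) \<Rightarrow> bool" where
  "imhd_steady_state \<psi> \<Phi> \<longleftrightarrow>
     imhd_solution (\<lambda>t. laplace \<psi>) (\<lambda>t x. \<Phi> x - laplace \<Phi> x) (\<lambda>t. \<psi>) (\<lambda>t. \<Phi>)"

definition psi_star :: "int \<Rightarrow> real \<times> real \<Rightarrow> real" where
  "psi_star k x = sin (of_int k * fst x)"

definition Phi_star :: "real \<Rightarrow> int \<Rightarrow> real \<times> real \<Rightarrow> real" where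
  "Phi_star a k x = a * sin (of_int k * fst x)"

text \<open>
  The linearization around \<^term>\<open>psi_star k\<close>, \<^term>\<open>Phi_star a k\<close>, for complex-valued perturbations.
  Since \<open>\<Delta>\<psi>\<^sub>* = -k^2 \<psi>\<^sub>*\<close>, \<open>\<Phi>\<^sub>* = a \<psi>\<^sub>*\<close> and \<open>(1 - \<Delta>)\<Phi>\<^sub>* = a(1 + k^2) \<psi>\<^sub>*\<close>, all its terms are
  advected by the single field \<^term>\<open>perp_grad (psi_star k)\<close>.
\<close>

definition linearized_solution ::
    "int \<Rightarrow> real \<Rightarrow> (real \<Rightarrow> real \<times> real \<Rightarrow> complex) \<Rightarrow> (real \<Rightarrow> real \<times> real \<Rightarrow> complex) \<Rightarrow> bool" where
  "linearized_solution k a \<omega> F \<longleftrightarrow>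
     (\<forall>t. torus_smooth (\<omega> t) \<and> mean_zero (\<omega> t) \<and> torus_smooth (F t)) \<and>
     (\<forall>t x. ((\<lambda>s. \<omega> s x) has_vector_derivative
        - advect (perp_grad (psi_star k))
            (\<lambda>y. (\<omega> t y + (of_int k)\<^sup>2 *\<^sub>R inv_laplace (\<omega> t) y)
               + a *\<^sub>R (F t y - (1 + (of_int k)\<^sup>2) *\<^sub>R inv_helmholtz (F t) y)) x) (at t)) \<and>
     (\<forall>t x. ((\<lambda>s. F s x) has_vector_derivative
        - advect (perp_grad (psi_star k))
            (\<lambda>y. F t y - (a * (1 + (of_int k)\<^sup>2)) *\<^sub>R inv_laplace (\<omega> t) y) x) (at t))"

end

theory Submission
  imports Defs "Jordan_Normal_Form.Char_Poly" "HOL-Complex_Analysis.Great_Picard"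
begin

text \<open>
  In the mode \<open>exp (i x\<^sub>2)\<close>, restricted to functions of \<open>k x\<^sub>1\<close>, the eigenvalue problem is a real two-component
  three-term recurrence \<open>l v + C M v = 0\<close>, where \<open>C\<close> is the skew difference operator coming from
  \<open>i k cos (k x\<^sub>1)\<close> and \<open>M\<close> is block diagonal with \<open>2 \<times> 2\<close> blocks.  Truncate to an even number of modes.
  Then \<open>det (C M)\<close> is a square times the product of the block determinants, of which exactly one is negative;
  so \<open>det (l + C M)\<close> is negative at \<open>l = 0\<close> and positive for large \<open>l\<close>, and the truncated problem has a positive
  eigenvalue.  Skew-symmetry of \<open>C\<close> gives bounds uniform in the truncation which show that the eigenvectors keep
  a definite mass in the low modes, so a subsequence converges to a nonzero solution of the full recurrence.
  Its eigenvalue is not zero, because \<open>C\<close> is injective on square-summable sequences and every block of \<open>M\<close> is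
  invertible.  Energy estimates with exponential weights make the limit decay exponentially, so it is the sequence
  of Fourier coefficients of a smooth eigenfunction.
\<close>

subsection \<open>Positive eigenvalues from a negative determinant\<close>

text \<open>The coefficient \<open>cos (k x1)\<close> couples only modes whose
  \<open>x1\<close>-frequencies differ by \<open>k\<close>, so functions of \<open>k x1\<close> form
  an invariant class. There \<open>- Delta\<close> has the symbol \<open>1 + k^2 n^2\<close>, which
  is below the value \<open>k^2\<close> of the steady state only at \<open>n = 0\<close>: this one
  mode supplies the negative block determinant. The main obstacle is that \<open>M\<close> is
  neither symmetric nor close to the identity. At high modes its blocks tend to the one with rows
  \<open>(1, a)\<close> and \<open>(0, 1)\<close>. The estimates follow this triangular form:
  \<open>F\<close> is driven only by a multiple of \<open>q H\<close>, then \<open>H\<close> by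
  \<open>q H\<close> and a bounded multiple of \<open>F\<close>. Everything is thus controlled by
  \<open>q H\<close>, and the decay of \<open>q\<close> supplies compactness. The second obstacle is
  that the truncated eigenvalues have no lower bound known in advance. Hence there are two energy
  estimates: one without \<open>l\<close>, which keeps the limit nonzero, and a weighted one, used
  only once the limit eigenvalue is known to be positive.\<close>

lemma real_poly_pos_root:
  fixes p :: "real poly"
  assumes "lead_coeff p > 0" "poly p 0 < 0"
  shows "\<exists>x>0. poly p x = 0"
proof -
  obtain n where n: "\<And>x. x \<ge> n \<Longrightarrow> poly p x \<ge> lead_coeff p"
    using poly_pinfty_gt_lc[OF assms(1)] by blast
  have "poly p (max n 1) > 0" using n[of "max n 1"] assms(1) by linarith
  moreover have "0 < max n 1" by simp
  ultimately show ?thesis using poly_IVT_pos[of 0 "max n 1" p] assms(2) by blast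
qed

text \<open>Both components are acted on by the same \<open>C\<close>, so its contribution to the
  determinant is \<open>(det C)^2\<close>, and the sign is decided by the pointwise
  \<open>2 x 2\<close> blocks alone. Lower right entries equal to 1 commute with the other diagonal
  blocks, which reduces the block determinant to the product in \<open>neg\<close>.\<close>

lemma det_block_diag_negative_root:
  fixes C :: "real mat" and d1 d2 d3 :: "nat \<Rightarrow> real"
  assumes C: "C \<in> carrier_mat n n" and detC: "Determinant.det C \<noteq> 0"
    and neg: "(\<Prod>i<n. d1 i - d2 i * d3 i) < 0"
  shows "\<exists>l u v. l > 0 \<and> (\<exists>i<n. u i \<noteq> 0 \<or> v i \<noteq> 0) \<and>
    (\<forall>i<n. l * u i + (\<Sum>j<n. C $$ (i,j) * (d1 j * u j + d2 j * v j)) = 0) \<and>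
    (\<forall>i<n. l * v i + (\<Sum>j<n. C $$ (i,j) * (d3 j * u j + v j)) = 0)"
proof -
  define dg :: "(nat \<Rightarrow> real) \<Rightarrow> real mat" where "dg d = Matrix.mat n n (\<lambda>(i,j). if i = j then d i else 0)" for d
  have dg[simp]: "dg d \<in> carrier_mat n n" for d by (simp add: dg_def)
  have dgm: "dg d * dg e = dg (\<lambda>i. d i * e i)" for d e
    by (rule eq_matI) (auto simp: dg_def scalar_prod_def if_distrib[where f="\<lambda>x. x * _"] cong: if_cong)
  have detdg: "Determinant.det (dg d) = (\<Prod>i<n. d i)" for d
    by (subst det_upper_triangular[of _ n])
      (auto simp: dg_def diag_mat_def prod.list_conv_set_nth atLeast0LessThan intro!: prod.cong)
  define D where "D = four_block_mat (dg d1) (dg d2) (dg d3) (dg (\<lambda>_. 1))"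
  define E where "E = four_block_mat C (0\<^sub>m n n) (0\<^sub>m n n) C"
  have DE[simp]: "D \<in> carrier_mat (n+n) (n+n)" "E \<in> carrier_mat (n+n) (n+n)"
    using C by (simp_all add: D_def E_def)
  have "Determinant.det D = Determinant.det (dg d1 * dg (\<lambda>_. 1) - dg d2 * dg d3)"
    unfolding D_def by (rule det_four_block_mat[of _ n]) (simp_all add: dgm)
  also have "dg d1 * dg (\<lambda>_. 1) - dg d2 * dg d3 = dg (\<lambda>i. d1 i - d2 i * d3 i)"
    unfolding dgm by (rule eq_matI) (auto simp: dg_def)
  finally have "Determinant.det D < 0" using neg by (simp add: detdg)
  moreover have "Determinant.det E = Determinant.det C * Determinant.det C"
    unfolding E_def by (rule det_four_block_mat_upper_right_zero[OF C refl _ C]) simp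
  ultimately have neg': "Determinant.det (E * D) < 0"
    using detC by (metis DE det_mult mult_pos_neg not_real_square_gt_zero)
  \<comment> \<open>The sign makes an eigenvector of \<open>A\<close> for \<open>l\<close> a
    solution of \<open>l w + E D w = 0\<close>, and the characteristic polynomial takes the value
    \<open>det (- A) = det (E * D)\<close> at 0.\<close>
  define A where "A = - (E * D)"
  have ED: "E * D \<in> carrier_mat (n+n) (n+n)" by (rule mult_carrier_mat[OF DE(2,1)])
  then have A: "A \<in> carrier_mat (n+n) (n+n)" unfolding A_def by simp
  have "- char_matrix A 0 = - A"
    unfolding char_matrix_def using A by (intro eq_matI) auto
  also have "\<dots> = E * D" unfolding A_def using ED by (intro eq_matI) auto
  finally have "- char_matrix A 0 = E * D" .
  then have "poly (char_poly A) 0 < 0" using neg' by (simp add: char_poly_matrix[OF A])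
  moreover have "lead_coeff (char_poly A) > 0" using degree_monic_char_poly[OF A] by simp
  ultimately obtain l where l: "l > 0" "poly (char_poly A) l = 0" using real_poly_pos_root by blast
  then obtain w where w: "w \<in> carrier_vec (n+n)" "w \<noteq> 0\<^sub>v (n+n)" "A *\<^sub>v w = l \<cdot>\<^sub>v w"
    using A unfolding eigenvalue_root_char_poly[OF A, symmetric] eigenvalue_def eigenvector_def by auto
  define u where "u = (\<lambda>i. vec_index w i)"
  define v where "v = (\<lambda>i. vec_index w (n+i))"
  have wuv: "w = Matrix.vec n u @\<^sub>v Matrix.vec n v"
    by (rule eq_vecI) (use w in \<open>auto simp: u_def v_def\<close>)
  have dgv: "dg d *\<^sub>v Matrix.vec n f = Matrix.vec n (\<lambda>i. d i * f i)" for d f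
    by (rule eq_vecI) (simp_all add: dg_def scalar_prod_def if_distrib[where f="\<lambda>x. x * _"] cong: if_cong)
  define X where "X = (\<lambda>j. d1 j * u j + d2 j * v j)"
  define Y where "Y = (\<lambda>j. d3 j * u j + v j)"
  have vc: "Matrix.vec n f \<in> carrier_vec n" for f :: "nat \<Rightarrow> real" by simp
  have Dw: "D *\<^sub>v w = Matrix.vec n X @\<^sub>v Matrix.vec n Y"
    unfolding D_def
  proof (subst wuv, subst four_block_mat_mult_vec[OF dg dg dg dg vc vc], unfold dgv, rule arg_cong2[where f = "(@\<^sub>v)"])
    show "Matrix.vec n (\<lambda>i. d1 i * u i) + Matrix.vec n (\<lambda>i. d2 i * v i) = Matrix.vec n X"
      by (rule eq_vecI) (simp_all add: X_def)
    show "Matrix.vec n (\<lambda>i. d3 i * u i) + Matrix.vec n (\<lambda>i. 1 * v i) = Matrix.vec n Y"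
      by (rule eq_vecI) (simp_all add: Y_def)
  qed
  have C0: "0\<^sub>m n n *\<^sub>v Matrix.vec n f = (0\<^sub>v n :: real vec)" for f :: "nat \<Rightarrow> real"
    by (rule eq_vecI) (auto simp: scalar_prod_def)
  have Ew: "E *\<^sub>v (D *\<^sub>v w) = (C *\<^sub>v Matrix.vec n X) @\<^sub>v (C *\<^sub>v Matrix.vec n Y)"
    unfolding E_def Dw four_block_mat_mult_vec[OF C zero_carrier_mat zero_carrier_mat C vc vc] C0
    using C by (intro arg_cong2[where f="(@\<^sub>v)"] eq_vecI) auto
  define z where "z = E *\<^sub>v (D *\<^sub>v w)"
  have zc: "z \<in> carrier_vec (n+n)" unfolding z_def using DE w(1) by (metis mult_mat_vec_carrier)
  have "(E * D) *\<^sub>v w = z" unfolding z_def by (rule assoc_mult_mat_vec[OF DE(2,1) w(1)])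
  moreover have "A *\<^sub>v w = - ((E * D) *\<^sub>v w)"
    unfolding A_def using ED w(1) by (intro uminus_mult_mat_vec) auto
  ultimately have "- z = l \<cdot>\<^sub>v w" using w(3) by simp
  then have "vec_index (- z) i = vec_index (l \<cdot>\<^sub>v w) i" for i by simp
  then have eq: "- vec_index z i = l * vec_index w i" if "i < n+n" for i
    using that w(1) zc by (metis index_smult_vec(1) index_uminus_vec(1) carrier_vecD)
  have Cv: "vec_index (C *\<^sub>v Matrix.vec n f) i = (\<Sum>j<n. C $$ (i,j) * f j)" if "i < n" for i f
    using that C by (auto simp: scalar_prod_def atLeast0LessThan)
  have e1: "l * u i + (\<Sum>j<n. C $$ (i,j) * X j) = 0" if "i < n" for i
    using eq[of i] that C Cv[OF that, of X] unfolding z_def Ew by (simp add: u_def)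
  have e2: "l * v i + (\<Sum>j<n. C $$ (i,j) * Y j) = 0" if "i < n" for i
    using eq[of "n+i"] that C Cv[OF that, of Y] unfolding z_def Ew by (simp add: v_def)
  have "\<exists>i<n. u i \<noteq> 0 \<or> v i \<noteq> 0"
  proof (rule ccontr)
    assume "\<not> ?thesis"
    then have "w = 0\<^sub>v (n+n)" unfolding wuv by (intro eq_vecI) auto
    then show False using w by simp
  qed
  then show ?thesis using l e1 e2 unfolding X_def Y_def by blast
qed

subsection \<open>The truncated recurrence\<close>

locale imhd =
  fixes k :: int and a :: real
  assumes k2: "k \<ge> 2" and a2: "a\<^sup>2 * (1 + (of_int k)\<^sup>2) < 2"
begin

text \<open>
  On the Fourier mode \<open>exp (i x\<^sub>2) exp (i k n x\<^sub>1)\<close> the operators \<open>- \<Delta>\<close> and \<open>1 - \<Delta>\<close> act as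
  multiplication by \<open>1 / q n\<close> and \<open>1 / r n\<close>.  The Fourier coefficients of the perturbation are written
  \<open>i^n H n\<close> and \<open>i^n F n\<close>: since multiplication by \<open>i cos (k x\<^sub>1)\<close> shifts \<open>n\<close> by one, the twist
  by \<open>i^n\<close> makes the eigenvalue problem real.  \<open>X\<close> and \<open>Y\<close> are the coefficients of the two brackets that
  are advected in the linearized system.
\<close>

definition K :: real where "K = of_int k"
definition q :: "int \<Rightarrow> real" where "q n = 1 / (1 + (K * of_int n)\<^sup>2)"
definition r :: "int \<Rightarrow> real" where "r n = 1 / (2 + (K * of_int n)\<^sup>2)"
definition d1 :: "int \<Rightarrow> real" where "d1 n = 1 - K\<^sup>2 * q n"
definition d2 :: "int \<Rightarrow> real" where "d2 n = a * (1 - (1 + K\<^sup>2) * r n)"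
definition d3 :: "int \<Rightarrow> real" where "d3 n = a * (1 + K\<^sup>2) * q n"
definition X :: "(int \<Rightarrow> real) \<Rightarrow> (int \<Rightarrow> real) \<Rightarrow> int \<Rightarrow> real" where
  "X H F n = d1 n * H n + d2 n * F n"
definition Y :: "(int \<Rightarrow> real) \<Rightarrow> (int \<Rightarrow> real) \<Rightarrow> int \<Rightarrow> real" where
  "Y H F n = d3 n * H n + F n"

text \<open>
  The number \<open>2N + 2\<close> of retained modes is even on purpose: for an odd number of modes the shift matrix is
  skew of odd size and hence singular.
\<close>

definition galerkin :: "nat \<Rightarrow> real \<Rightarrow> (int \<Rightarrow> real) \<Rightarrow> (int \<Rightarrow> real) \<Rightarrow> bool" where
  "galerkin N l H F \<longleftrightarrow> l > 0 \<and>
     (\<forall>n. n \<notin> {- int N..int N + 1} \<longrightarrow> H n = 0 \<and> F n = 0) \<and>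
     (\<Sum>n\<in>{- int N..int N + 1}. (H n)\<^sup>2 + (F n)\<^sup>2) = 1 \<and>
     (\<forall>n\<in>{- int N..int N + 1}.
        l * H n = K / 2 * (X H F (n + 1) - X H F (n - 1)) \<and>
        l * F n = K / 2 * (Y H F (n + 1) - Y H F (n - 1)))"

lemma K2: "K \<ge> 2" using k2 unfolding K_def by simp

lemma a2K: "a\<^sup>2 * (1 + K\<^sup>2) < 2" using a2 unfolding K_def .

text \<open>
  The determinant of the \<open>2 \<times> 2\<close> symbol \<open>(H n, F n) \<mapsto> (X n, Y n)\<close>; the hypothesis on \<open>a\<close>
  enters only through its sign.
\<close>

lemma det_mode:
  "d1 n - d2 n * d3 n = (K\<^sup>2 * (of_int n)\<^sup>2 + 1 - K\<^sup>2) * (1 - a\<^sup>2 * (1 + K\<^sup>2) * r n) * q n"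
proof -
  have "1 + (K * of_int n)\<^sup>2 \<noteq> 0" "2 + (K * of_int n)\<^sup>2 \<noteq> 0"
    by (smt (verit) zero_le_power2)+
  then show ?thesis
    unfolding d1_def d2_def d3_def q_def r_def
    by (simp add: divide_simps) (simp add: power2_eq_square algebra_simps)
qed

lemma q_pos: "q n > 0" unfolding q_def by (simp add: add_pos_nonneg)

lemma q_le1: "q n \<le> 1" unfolding q_def by (simp add: divide_le_eq add_pos_nonneg)

lemma r_bounds: "0 < r n" "r n \<le> 1/2"
  unfolding r_def by (simp_all add: add_pos_nonneg field_simps)

text \<open>The largest value of \<open>r\<close> is \<open>r 0 = 1/2\<close>; this is the origin of
  the bound 2 in the hypothesis on \<open>a\<close>.\<close>

lemma factor_pos: "1 - a\<^sup>2 * (1 + K\<^sup>2) * r n > 0"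
proof -
  have "a\<^sup>2 * (1 + K\<^sup>2) * r n \<le> a\<^sup>2 * (1 + K\<^sup>2) * (1/2)"
    by (intro mult_left_mono r_bounds) simp
  then show ?thesis using a2K by linarith
qed

text \<open>At \<open>n = 0\<close> the first factor of \<open>det_mode\<close> is
  \<open>1 - K^2\<close>: the transverse wave number 1 is smaller than the wave number
  \<open>k\<close> of the shear. This is the source of the instability.\<close>

lemma det_mode_0: "d1 0 - d2 0 * d3 0 < 0"
proof -
  have "K * K \<ge> 2 * 2" using K2 by (intro mult_mono) auto
  then have "1 - K\<^sup>2 < 0" by (simp add: power2_eq_square)
  then show ?thesis unfolding det_mode using factor_pos[of 0] q_pos[of 0]
    by (simp add: mult_neg_pos)
qed

lemma det_mode_pos: "n \<noteq> 0 \<Longrightarrow> d1 n - d2 n * d3 n > 0"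
proof -
  assume "n \<noteq> 0"
  then have "n\<^sup>2 \<ge> 1" by (simp add: int_one_le_iff_zero_less)
  then have "(of_int n)\<^sup>2 \<ge> (1::real)" by (metis of_int_1_le_iff of_int_power)
  then have "K\<^sup>2 * (of_int n)\<^sup>2 \<ge> K\<^sup>2 * 1" by (intro mult_left_mono) auto
  then have "K\<^sup>2 * (of_int n)\<^sup>2 + 1 - K\<^sup>2 > 0" by linarith
  then show ?thesis unfolding det_mode using factor_pos[of n] q_pos[of n] by simp
qed

lemma det_mode_nz: "d1 n - d2 n * d3 n \<noteq> 0"
  using det_mode_0 det_mode_pos[of n] by (cases "n = 0") auto

end

section \<open>The truncated shift matrix and its invertibility in even size\<close>

definition zext :: "nat \<Rightarrow> (nat \<Rightarrow> real) \<Rightarrow> int \<Rightarrow> real" where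
  "zext n f m = (if 0 \<le> m \<and> m < int n then f (nat m) else 0)"

definition shift_mat :: "nat \<Rightarrow> real \<Rightarrow> real mat" where
  "shift_mat n c = Matrix.mat n n (\<lambda>(i,j). if i = j + 1 then c else if j = i + 1 then - c else 0)"

text \<open>Extension by zero gives the first and last rows the same form as the inner ones, so with
  \<open>c = K / 2\<close> the matrix equations become those of \<open>galerkin\<close> without
  boundary cases.\<close>

lemma shift_mat_sum:
  assumes "i < n"
  shows "(\<Sum>j<n. shift_mat n c $$ (i,j) * f j) = c * (zext n f (int i - 1) - zext n f (int i + 1))"
proof -
  \<comment> \<open>Natural subtraction gives \<open>i - 1 = 0\<close> at \<open>i = 0\<close>, so
    the missing left neighbour has to be removed by hand; the missing right neighbour
    \<open>i + 1 = n\<close> lies outside the summation range.\<close>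
  have "(\<Sum>j<n. shift_mat n c $$ (i,j) * f j) =
      (\<Sum>j<n. (if j = i - 1 then (if i = 0 then 0 else c * f j) else 0) - (if j = i + 1 then c * f j else 0))"
    using assms by (intro sum.cong) (auto simp: shift_mat_def)
  also have "\<dots> = c * (zext n f (int i - 1) - zext n f (int i + 1))"
    unfolding sum_subtractf
    using assms by (auto simp: zext_def nat_diff_distrib algebra_simps nat_add_distrib)
  finally show ?thesis .
qed

text \<open>A kernel vector, extended by zero, satisfies \<open>z (m + 1) = z (m - 1)\<close> in
  every row. The zero at index -1 spreads upwards through the odd indices, the zero at index
  \<open>n\<close> downwards through the even ones. For even \<open>n\<close> these two zeros have
  different parity, so nothing survives.\<close>

lemma det_shift_mat:
  assumes "even n" "c \<noteq> 0"
  shows "Determinant.det (shift_mat n c) \<noteq> 0"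
proof
  have C: "shift_mat n c \<in> carrier_mat n n" by (simp add: shift_mat_def)
  assume "Determinant.det (shift_mat n c) = 0"
  then obtain v where v: "v \<in> carrier_vec n" "v \<noteq> 0\<^sub>v n" "shift_mat n c *\<^sub>v v = 0\<^sub>v n"
    using det_0_iff_vec_prod_zero[OF C] by blast
  define z where "z = zext n (vec_index v)"
  have out: "z m = 0" if "m < 0 \<or> m \<ge> int n" for m using that by (auto simp: z_def zext_def)
  have eq: "z (m + 1) = z (m - 1)" if "0 \<le> m" "m < int n" for m
  proof -
    obtain i where i: "m = int i" "i < n" using \<open>0 \<le> m\<close> \<open>m < int n\<close> by (metis nonneg_int_cases of_nat_less_iff)
    have "vec_index (shift_mat n c *\<^sub>v v) i = (\<Sum>j<n. shift_mat n c $$ (i,j) * vec_index v j)"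
      using i(2) v(1) C by (auto simp: scalar_prod_def atLeast0LessThan)
    then have "c * (z (int i - 1) - z (int i + 1)) = 0"
      using v(3) i(2) shift_mat_sum[OF i(2), of c "vec_index v"] by (simp add: z_def)
    then show ?thesis using assms(2) i(1) by simp
  qed
  obtain m where m: "n = 2 * m" using assms(1) by blast
  have odds: "z (2 * int j - 1) = 0" if "j \<le> m" for j
    using that
  proof (induction j)
    case 0 then show ?case by (simp add: out)
  next
    case (Suc j) then show ?case using eq[of "2 * int j"] m by (simp add: algebra_simps)
  qed
  have evens: "z (int n - 2 * int j) = 0" if "j \<le> m" for j
    using that
  proof (induction j)
    case 0 then show ?case by (simp add: out)
  next
    case (Suc j) then show ?case using eq[of "int n - 2 * int j - 1"] m by (simp add: algebra_simps)
  qed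
  have "vec_index v i = 0" if "i < n" for i
  proof -
    have zi: "vec_index v i = z (int i)" using that by (simp add: z_def zext_def)
    show ?thesis
    proof (cases "even i")
      case True
      then obtain j where "i = 2 * j" by blast
      then show ?thesis using evens[of "m - j"] m that zi by (simp add: of_nat_diff algebra_simps)
    next
      case False
      then obtain j where "i = 2 * j + 1" using oddE by blast
      then show ?thesis using odds[of "Suc j"] m that zi by (simp add: algebra_simps)
    qed
  qed
  then have "v = 0\<^sub>v n" using v(1) by (intro eq_vecI) auto
  then show False using v(2) by simp
qed

context imhd
begin

lemma galerkin_exists: "\<exists>l H F. galerkin N l H F"
proof -
  define n where "n = 2 * N + 2"
  define s where "s = (\<lambda>i::nat. int i - int N)"
  \<comment> \<open>Matrix index \<open>i\<close> stands for the mode \<open>s i = i - N\<close>.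
    Mode 0 sits at index \<open>N\<close> in every truncation, so exactly one factor is negative
    whatever \<open>N\<close> is.\<close>
  have "(\<Prod>i\<in>{..<n}. d1 (s i) - d2 (s i) * d3 (s i)) =
     (d1 (s N) - d2 (s N) * d3 (s N)) * (\<Prod>i\<in>{..<n}-{N}. d1 (s i) - d2 (s i) * d3 (s i))"
    by (rule prod.remove) (auto simp: n_def)
  moreover have "(\<Prod>i\<in>{..<n}-{N}. d1 (s i) - d2 (s i) * d3 (s i)) > 0"
    by (intro prod_pos ballI det_mode_pos) (auto simp: s_def)
  ultimately have neg: "(\<Prod>i<n. d1 (s i) - d2 (s i) * d3 (s i)) < 0"
    using det_mode_0 by (simp add: s_def mult_neg_pos)
  have "Determinant.det (shift_mat n (K/2)) \<noteq> 0"
    using K2 by (intro det_shift_mat) (auto simp: n_def)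
  then obtain l u v where l: "l > 0" and nz: "\<exists>i<n. u i \<noteq> 0 \<or> v i \<noteq> 0"
    and e1: "\<forall>i<n. l * u i + (\<Sum>j<n. shift_mat n (K/2) $$ (i,j) * (d1 (s j) * u j + d2 (s j) * v j)) = 0"
    and e2: "\<forall>i<n. l * v i + (\<Sum>j<n. shift_mat n (K/2) $$ (i,j) * (d3 (s j) * u j + v j)) = 0"
    using det_block_diag_negative_root[OF _ _ neg, of "shift_mat n (K/2)"] by (auto simp: shift_mat_def)
  define S where "S = {- int N..int N + 1}"
  define H where "H = (\<lambda>m. zext n u (m + int N))"
  define F where "F = (\<lambda>m. zext n v (m + int N))"
  have XH: "zext n (\<lambda>j. d1 (s j) * u j + d2 (s j) * v j) (m + int N) = X H F m" for m
    by (auto simp: zext_def X_def H_def F_def s_def)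
  have YH: "zext n (\<lambda>j. d3 (s j) * u j + v j) (m + int N) = Y H F m" for m
    by (auto simp: zext_def Y_def H_def F_def s_def)
  have out: "H m = 0 \<and> F m = 0" if "m \<notin> S" for m
    using that by (auto simp: H_def F_def zext_def S_def n_def)
  have eqs: "l * H m = K / 2 * (X H F (m + 1) - X H F (m - 1)) \<and>
        l * F m = K / 2 * (Y H F (m + 1) - Y H F (m - 1))" if "m \<in> S" for m
  proof -
    define i where "i = nat (m + int N)"
    have i: "i < n" "int i = m + int N" using that by (auto simp: i_def S_def n_def)
    have hi: "H m = u i" "F m = v i" using i by (auto simp: H_def F_def zext_def i_def)
    have *: "int i + 1 = (m + 1) + int N" "int i - 1 = (m - 1) + int N" using i by auto
    show ?thesis
      using e1[rule_format, OF i(1)] e2[rule_format, OF i(1)]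
      unfolding shift_mat_sum[OF i(1)] * XH YH hi by (simp add: algebra_simps)
  qed
  define c where "c = (\<Sum>m\<in>S. (H m)\<^sup>2 + (F m)\<^sup>2)"
  have "c > 0"
  proof -
    obtain i where i: "i < n" "u i \<noteq> 0 \<or> v i \<noteq> 0" using nz by blast
    then have "int i - int N \<in> S" by (auto simp: S_def n_def)
    moreover have "(H (int i - int N))\<^sup>2 + (F (int i - int N))\<^sup>2 > 0"
      using i by (auto simp: H_def F_def zext_def sum_power2_gt_zero_iff)
    ultimately show ?thesis unfolding c_def by (intro sum_pos2[of S]) (auto simp: S_def)
  qed
  define t where "t = 1 / sqrt c"
  have tc: "t\<^sup>2 * c = 1" using \<open>c > 0\<close> by (simp add: t_def power_divide)
  have Xt: "X (\<lambda>m. t * H m) (\<lambda>m. t * F m) m = t * X H F m" for m by (simp add: X_def algebra_simps)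
  have Yt: "Y (\<lambda>m. t * H m) (\<lambda>m. t * F m) m = t * Y H F m" for m by (simp add: Y_def algebra_simps)
  have "(\<Sum>m\<in>S. (t * H m)\<^sup>2 + (t * F m)\<^sup>2) = 1"
    using tc unfolding c_def sum_distrib_left by (simp add: power_mult_distrib algebra_simps)
  moreover have "l * (t * H m) = K / 2 * (t * X H F (m + 1) - t * X H F (m - 1)) \<and>
        l * (t * F m) = K / 2 * (t * Y H F (m + 1) - t * Y H F (m - 1))" if "m \<in> S" for m
    using arg_cong[OF conjunct1[OF eqs[OF that]], of "\<lambda>x. t * x"]
      arg_cong[OF conjunct2[OF eqs[OF that]], of "\<lambda>x. t * x"] by (simp add: algebra_simps)
  ultimately have "galerkin N l (\<lambda>m. t * H m) (\<lambda>m. t * F m)"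
    using l out unfolding galerkin_def Xt Yt S_def by simp
  then show ?thesis by blast
qed

end

subsection \<open>Energy bounds for skew recurrences\<close>

text \<open>The summation range is padded by one index on each side, so the support stays inside it
  after a shift by one and summation by parts has no boundary terms.\<close>

lemma sum_shift_supp:
  fixes g :: "int \<Rightarrow> real"
  assumes "\<And>n. n \<notin> {lo..hi} \<Longrightarrow> g n = 0"
  shows "(\<Sum>n\<in>{lo-1..hi+1}. g (n + 1)) = (\<Sum>n\<in>{lo-1..hi+1}. g n)"
    and "(\<Sum>n\<in>{lo-1..hi+1}. g (n - 1)) = (\<Sum>n\<in>{lo-1..hi+1}. g n)"
proof -
  have "(\<Sum>n\<in>{lo-1..hi+1}. g (n + 1)) = (\<Sum>n\<in>{lo..hi+2}. g n)"
    by (rule sum.reindex_bij_witness[of _ "\<lambda>n. n - 1" "\<lambda>n. n + 1"]) auto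
  also have "\<dots> = (\<Sum>n\<in>{lo..hi}. g n)"
    by (rule sum.mono_neutral_right) (auto simp: assms)
  also have "\<dots> = (\<Sum>n\<in>{lo-1..hi+1}. g n)"
    by (rule sum.mono_neutral_left) (auto simp: assms)
  finally show "(\<Sum>n\<in>{lo-1..hi+1}. g (n + 1)) = (\<Sum>n\<in>{lo-1..hi+1}. g n)" .
  have "(\<Sum>n\<in>{lo-1..hi+1}. g (n - 1)) = (\<Sum>n\<in>{lo-2..hi}. g n)"
    by (rule sum.reindex_bij_witness[of _ "\<lambda>n. n + 1" "\<lambda>n. n - 1"]) auto
  also have "\<dots> = (\<Sum>n\<in>{lo..hi}. g n)"
    by (rule sum.mono_neutral_right) (auto simp: assms)
  also have "\<dots> = (\<Sum>n\<in>{lo-1..hi+1}. g n)"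
    by (rule sum.mono_neutral_left) (auto simp: assms)
  finally show "(\<Sum>n\<in>{lo-1..hi+1}. g (n - 1)) = (\<Sum>n\<in>{lo-1..hi+1}. g n)" .
qed

text \<open>
  Pairing the equation with \<open>A + Z\<close> kills its right-hand side by skew-symmetry; the bound is therefore
  independent of \<open>l\<close> and survives even if the eigenvalues of the truncations tend to zero.
\<close>

lemma skew_energy_bound:
  fixes A Z :: "int \<Rightarrow> real"
  assumes supp: "\<And>n. n \<notin> {lo..hi} \<Longrightarrow> A n = 0 \<and> Z n = 0" and "l > 0"
    and eq: "\<And>n. n \<in> {lo..hi} \<Longrightarrow>
      l * A n = c * ((A (n + 1) + Z (n + 1)) - (A (n - 1) + Z (n - 1)))"
  shows "(\<Sum>n\<in>{lo-1..hi+1}. (A n)\<^sup>2) \<le> (\<Sum>n\<in>{lo-1..hi+1}. (Z n)\<^sup>2)"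
proof -
  let ?J = "{lo-1..hi+1}"
  define B where "B n = A n + Z n" for n
  have B0: "B n = 0" if "n \<notin> {lo..hi}" for n using supp[OF that] by (simp add: B_def)
  have "l * (B n * A n) = c * (B (n + 1) * B n - B n * B (n - 1))" for n
  proof (cases "n \<in> {lo..hi}")
    case True
    then have "B n * (l * A n) = B n * (c * (B (n + 1) - B (n - 1)))" using eq[OF True] by (simp add: B_def)
    then show ?thesis by (simp add: algebra_simps)
  qed (simp add: B0)
  then have "l * (\<Sum>n\<in>?J. B n * A n) = c * ((\<Sum>n\<in>?J. B (n + 1) * B n) - (\<Sum>n\<in>?J. B n * B (n - 1)))"
    by (simp add: sum_distrib_left sum_subtractf[symmetric])
  moreover have "(\<Sum>n\<in>?J. B (n + 1) * B ((n + 1) - 1)) = (\<Sum>n\<in>?J. B n * B (n - 1))"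
    by (rule sum_shift_supp(1)) (auto simp: B0)
  ultimately have "(\<Sum>n\<in>?J. B n * A n) = 0" using \<open>l > 0\<close> by simp
  then have "(\<Sum>n\<in>?J. (A n)\<^sup>2 + A n * Z n) = 0"
    by (simp add: B_def power2_eq_square algebra_simps)
  moreover have "(\<Sum>n\<in>?J. (A n)\<^sup>2 / 2 - (Z n)\<^sup>2 / 2) \<le> (\<Sum>n\<in>?J. (A n)\<^sup>2 + A n * Z n)"
  proof (rule sum_mono)
    fix n
    have "0 \<le> (A n + Z n)\<^sup>2" by simp
    then show "(A n)\<^sup>2 / 2 - (Z n)\<^sup>2 / 2 \<le> (A n)\<^sup>2 + A n * Z n" unfolding power2_sum by linarith
  qed
  ultimately show ?thesis by (simp add: sum_subtractf sum_divide_distrib[symmetric])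
qed

text \<open>Weights destroy the exact skew cancellation and leave the commutator
  \<open>(w n)^2 - (w (n + 1))^2\<close>. The condition on \<open>\<epsilon>\<close> lets the
  commutator cost at most \<open>l / 2\<close> times the energy of \<open>A\<close>, and Young's
  inequality spends a further \<open>l / 4\<close> on the source \<open>Z\<close>. The remaining
  \<open>l / 4\<close> gives the bound, with \<open>16 = 4 * 4\<close>. Unlike in the unweighted
  estimate, a lower bound \<open>l\<close> for the eigenvalue is needed to absorb these
  terms.\<close>

lemma weighted_energy_bound:
  fixes A Z w :: "int \<Rightarrow> real"
  assumes supp: "\<And>n. n \<notin> {lo..hi} \<Longrightarrow> A n = 0 \<and> Z n = 0" and l: "l > 0" "l \<le> l'" and "c > 0"
    and w: "\<And>n. w n > 0" "\<And>n. w n \<le> \<rho> * w (n + 1)" "\<And>n. w (n + 1) \<le> \<rho> * w n"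
      "\<And>n. \<bar>(w n)\<^sup>2 - (w (n + 1))\<^sup>2\<bar> \<le> \<epsilon> * (w n * w (n + 1))"
    and \<epsilon>: "c * \<epsilon> \<le> l / 2"
    and eq: "\<And>n. n \<in> {lo..hi} \<Longrightarrow>
      l' * A n = c * ((A (n + 1) + Z (n + 1)) - (A (n - 1) + Z (n - 1)))"
  shows "(\<Sum>n\<in>{lo-1..hi+1}. (w n * A n)\<^sup>2) \<le> 16 * c\<^sup>2 * \<rho>\<^sup>2 / l\<^sup>2 * (\<Sum>n\<in>{lo-1..hi+1}. (w n * Z n)\<^sup>2)"
proof -
  let ?J = "{lo-1..hi+1}"
  define EA where "EA = (\<Sum>n\<in>?J. (w n * A n)\<^sup>2)"
  define EZ where "EZ = (\<Sum>n\<in>?J. (w n * Z n)\<^sup>2)"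
  have "\<epsilon> \<ge> 0" using w(4)[of 0] w(1)[of 0] w(1)[of 1] by (smt (verit) mult_pos_pos mult_neg_pos add_0)
  have "\<rho> \<ge> 0" using w(2)[of 0] w(1)[of 0] w(1)[of 1] by (smt (verit) mult_neg_pos add_0)
  have shift: "(\<Sum>n\<in>?J. f (n + 1)) = (\<Sum>n\<in>?J. f n)" "(\<Sum>n\<in>?J. f (n - 1)) = (\<Sum>n\<in>?J. f n)"
    if "\<And>n. n \<notin> {lo..hi} \<Longrightarrow> f n = 0" for f :: "int \<Rightarrow> real"
    using sum_shift_supp[of lo hi f] that by auto
  have pt: "l' * (w n * A n)\<^sup>2 = c * ((w n)\<^sup>2 * A n * A (n + 1) - (w n)\<^sup>2 * A n * A (n - 1))
      + c * ((w n)\<^sup>2 * A n * (Z (n + 1) - Z (n - 1)))" for n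
  proof (cases "n \<in> {lo..hi}")
    case True
    have "(w n)\<^sup>2 * A n * (l' * A n) = (w n)\<^sup>2 * A n * (c * ((A (n + 1) + Z (n + 1)) - (A (n - 1) + Z (n - 1))))"
      using eq[OF True] by simp
    then show ?thesis by (simp add: algebra_simps power2_eq_square)
  qed (simp add: supp)
  have "l' * EA = c * ((\<Sum>n\<in>?J. (w n)\<^sup>2 * A n * A (n + 1)) - (\<Sum>n\<in>?J. (w n)\<^sup>2 * A n * A (n - 1)))
      + c * (\<Sum>n\<in>?J. (w n)\<^sup>2 * A n * (Z (n + 1) - Z (n - 1)))"
    unfolding EA_def sum_distrib_left pt by (simp add: sum.distrib sum_subtractf sum_distrib_left algebra_simps)
  also have "(\<Sum>n\<in>?J. (w n)\<^sup>2 * A n * A (n - 1)) = (\<Sum>n\<in>?J. (w (n+1))\<^sup>2 * A n * A (n + 1))"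
    using shift(1)[of "\<lambda>n. (w n)\<^sup>2 * A n * A (n - 1)"] supp by (simp add: mult_ac)
  also have "(\<Sum>n\<in>?J. (w n)\<^sup>2 * A n * A (n + 1)) - (\<Sum>n\<in>?J. (w (n+1))\<^sup>2 * A n * A (n + 1))
      = (\<Sum>n\<in>?J. ((w n)\<^sup>2 - (w (n+1))\<^sup>2) * (A n * A (n + 1)))"
    by (simp add: sum_subtractf[symmetric] algebra_simps)
  also have "\<dots> \<le> (\<Sum>n\<in>?J. \<epsilon> * ((w n * A n)\<^sup>2 / 2 + (w (n+1) * A (n+1))\<^sup>2 / 2))"
  proof (rule sum_mono)
    fix n
    have "((w n)\<^sup>2 - (w (n+1))\<^sup>2) * (A n * A (n + 1)) \<le> \<bar>(w n)\<^sup>2 - (w (n+1))\<^sup>2\<bar> * \<bar>A n * A (n + 1)\<bar>"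
      by (metis abs_ge_self abs_mult)
    also have "\<dots> \<le> \<epsilon> * (w n * w (n + 1)) * \<bar>A n * A (n + 1)\<bar>"
      by (intro mult_right_mono w(4)) simp
    also have "\<dots> = \<epsilon> * (\<bar>w n * A n\<bar> * \<bar>w (n+1) * A (n+1)\<bar>)"
      using w(1)[of n] w(1)[of "n+1"] by (simp add: abs_mult)
    also have "\<dots> \<le> \<epsilon> * ((w n * A n)\<^sup>2 / 2 + (w (n+1) * A (n+1))\<^sup>2 / 2)"
    proof (rule mult_left_mono[OF _ \<open>\<epsilon> \<ge> 0\<close>])
      have "0 \<le> (\<bar>w n * A n\<bar> - \<bar>w (n+1) * A (n+1)\<bar>)\<^sup>2" by simp
      then show "\<bar>w n * A n\<bar> * \<bar>w (n+1) * A (n+1)\<bar> \<le> (w n * A n)\<^sup>2 / 2 + (w (n+1) * A (n+1))\<^sup>2 / 2"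
        unfolding power2_diff power2_abs by linarith
    qed
    finally show "((w n)\<^sup>2 - (w (n+1))\<^sup>2) * (A n * A (n + 1)) \<le> \<epsilon> * ((w n * A n)\<^sup>2 / 2 + (w (n+1) * A (n+1))\<^sup>2 / 2)" .
  qed
  also have "\<dots> = \<epsilon> * EA"
    using shift(1)[of "\<lambda>n. (w n * A n)\<^sup>2"] supp
    by (simp add: EA_def sum_distrib_left[symmetric] sum.distrib sum_divide_distrib[symmetric])
  also have "(\<Sum>n\<in>?J. (w n)\<^sup>2 * A n * (Z (n + 1) - Z (n - 1))) \<le>
     (\<Sum>n\<in>?J. l / (4 * c) * (w n * A n)\<^sup>2 +
        2 * c * \<rho>\<^sup>2 / l * ((w (n + 1) * Z (n + 1))\<^sup>2 + (w (n - 1) * Z (n - 1))\<^sup>2))"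
  proof (rule sum_mono)
    fix n
    \<comment> \<open>The weight \<open>l / (8 * c)\<close> is chosen so that the two neighbours
      \<open>n + 1\<close> and \<open>n - 1\<close> together cost \<open>l / (4 * c)\<close>, that
      is \<open>l / 4\<close> after multiplication by \<open>c\<close>.\<close>
    have young: "x * y \<le> l / (8 * c) * x\<^sup>2 + 2 * c / l * y\<^sup>2" for x y :: real
    proof -
      have "0 \<le> (l * x - 4 * c * y)\<^sup>2 / (8 * c * l)" using l \<open>c > 0\<close> by simp
      also have "\<dots> = l / (8 * c) * x\<^sup>2 + 2 * c / l * y\<^sup>2 - x * y"
        using l \<open>c > 0\<close> by (simp add: field_simps power2_eq_square)
      finally show ?thesis by simp
    qed
    have split: "(w n)\<^sup>2 * A n * s \<le> l / (8 * c) * (w n * A n)\<^sup>2 + 2 * c * \<rho>\<^sup>2 / l * (w m * s)\<^sup>2"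
      if "w n \<le> \<rho> * w m" for m s
    proof -
      have "(w n)\<^sup>2 * A n * s = (w n * A n) * (w n * s)" by (simp add: power2_eq_square)
      also have "\<dots> \<le> l / (8 * c) * (w n * A n)\<^sup>2 + 2 * c / l * (w n * s)\<^sup>2" by (rule young)
      also have "(w n * s)\<^sup>2 \<le> (\<rho> * w m * s)\<^sup>2"
        unfolding power_mult_distrib[of _ s] using that w(1)[of n]
        by (intro mult_right_mono power_mono) auto
      then have "2 * c / l * (w n * s)\<^sup>2 \<le> 2 * c / l * (\<rho> * w m * s)\<^sup>2"
        using l \<open>c > 0\<close> by (intro mult_left_mono) auto
      finally show ?thesis by (simp add: power_mult_distrib mult_ac)
    qed
    have "(w n)\<^sup>2 * A n * (Z (n + 1) - Z (n - 1)) =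
        (w n)\<^sup>2 * A n * Z (n + 1) + (w n)\<^sup>2 * A n * (- Z (n - 1))" by (simp add: algebra_simps)
    also have "\<dots> \<le> (l / (8 * c) * (w n * A n)\<^sup>2 + 2 * c * \<rho>\<^sup>2 / l * (w (n+1) * Z (n+1))\<^sup>2)
      + (l / (8 * c) * (w n * A n)\<^sup>2 + 2 * c * \<rho>\<^sup>2 / l * (w (n-1) * (- Z (n-1)))\<^sup>2)"
      using w(2)[of n] w(3)[of "n - 1"] by (intro add_mono split) auto
    also have "\<dots> = l / (4 * c) * (w n * A n)\<^sup>2 +
        2 * c * \<rho>\<^sup>2 / l * ((w (n + 1) * Z (n + 1))\<^sup>2 + (w (n - 1) * Z (n - 1))\<^sup>2)"
      by (simp add: distrib_left)
    finally show "(w n)\<^sup>2 * A n * (Z (n + 1) - Z (n - 1)) \<le> \<dots>" .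
  qed
  also have "\<dots> = l / (4 * c) * EA + 2 * c * \<rho>\<^sup>2 / l * (EZ + EZ)"
    using shift[of "\<lambda>n. (w n * Z n)\<^sup>2"] supp
    unfolding sum.distrib sum_distrib_left[symmetric] EA_def EZ_def by simp
  finally have main: "l' * EA \<le> c * (\<epsilon> * EA) + c * (l / (4 * c) * EA + 2 * c * \<rho>\<^sup>2 / l * (EZ + EZ))"
    using \<open>c > 0\<close> by (simp add: mult_left_mono add_mono)
  have "EA \<ge> 0" unfolding EA_def by (simp add: sum_nonneg)
  have 1: "l * EA \<le> l' * EA" using l \<open>EA \<ge> 0\<close> by (simp add: mult_right_mono)
  have 2: "c * (\<epsilon> * EA) \<le> l / 2 * EA" using mult_right_mono[OF \<epsilon> \<open>EA \<ge> 0\<close>] by (simp add: mult.assoc)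
  have 3: "c * (l / (4 * c) * EA + 2 * c * \<rho>\<^sup>2 / l * (EZ + EZ)) = l / 4 * EA + 4 * c\<^sup>2 * \<rho>\<^sup>2 / l * EZ"
    using \<open>c > 0\<close> by (simp add: distrib_left power2_eq_square)
  have "l * EA \<le> l / 2 * EA + (l / 4 * EA + 4 * c\<^sup>2 * \<rho>\<^sup>2 / l * EZ)"
    by (rule order_trans[OF 1 order_trans[OF main[unfolded 3] add_right_mono[OF 2]]])
  moreover have "l * EA = l / 2 * EA + l / 4 * EA + l / 4 * EA" by simp
  ultimately have "l / 4 * EA \<le> 4 * c\<^sup>2 * \<rho>\<^sup>2 / l * EZ" by linarith
  then have "4 / l * (l / 4 * EA) \<le> 4 / l * (4 * c\<^sup>2 * \<rho>\<^sup>2 / l * EZ)"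
    using l by (intro mult_left_mono) auto
  then have "EA \<le> 16 * c\<^sup>2 * \<rho>\<^sup>2 / l\<^sup>2 * EZ"
    using l by (simp add: power2_eq_square mult_ac)
  then show ?thesis unfolding EA_def EZ_def .
qed

subsection \<open>Bounds uniform in the truncation\<close>

text \<open>A nonzero value would recur at all \<open>n + 2 j\<close>, and enough copies of its
  square exceed \<open>B\<close>. This is the injectivity of the skew difference operator on
  square-summable sequences.\<close>

lemma two_periodic_square_summable_zero:
  fixes f :: "int \<Rightarrow> real"
  assumes per: "\<And>n. f (n + 1) = f (n - 1)" and bd: "\<And>T. finite T \<Longrightarrow> (\<Sum>n\<in>T. (f n)\<^sup>2) \<le> B"
  shows "f n = 0"
proof (rule ccontr)
  assume nz: "f n \<noteq> 0"
  have step: "f (n + 2 * int j) = f n" for j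
  proof (induction j)
    case (Suc j)
    then show ?case using per[of "n + 2 * int j + 1"] by (simp add: algebra_simps)
  qed simp
  obtain M :: nat where M: "B < real M * (f n)\<^sup>2"
    using reals_Archimedean3[of "(f n)\<^sup>2"] nz by auto
  have "(\<Sum>i\<in>(\<lambda>j. n + 2 * int j) ` {..<M}. (f i)\<^sup>2) = (\<Sum>j<M. (f (n + 2 * int j))\<^sup>2)"
    by (rule sum.reindex_cong[of "\<lambda>j. n + 2 * int j"]) (auto simp: inj_on_def)
  also have "\<dots> = real M * (f n)\<^sup>2" by (simp add: step)
  finally show False using bd[of "(\<lambda>j. n + 2 * int j) ` {..<M}"] M by simp
qed

context imhd
begin

definition c3 :: real where "c3 = a * (1 + K\<^sup>2)"
text \<open>A common bound for the absolute values of \<open>d1\<close>, \<open>d2\<close>,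
  \<open>d3\<close> and of the coefficient 1 in \<open>Y\<close>.\<close>

definition D :: real where "D = 1 + K\<^sup>2 + \<bar>a\<bar> * (2 + K\<^sup>2) + \<bar>c3\<bar>"

lemma d1_bound: "\<bar>d1 n\<bar> \<le> 1 + K\<^sup>2"
proof -
  have "0 \<le> K\<^sup>2 * q n" "K\<^sup>2 * q n \<le> K\<^sup>2 * 1"
    using q_pos[of n] q_le1[of n] by (simp, intro mult_left_mono) auto
  then show ?thesis unfolding d1_def by linarith
qed

lemma d2_bound: "\<bar>d2 n\<bar> \<le> \<bar>a\<bar> * (2 + K\<^sup>2)"
proof -
  define t where "t = (1 + K\<^sup>2) * r n"
  have "0 \<le> t" "t \<le> (1 + K\<^sup>2) * 1"
    unfolding t_def using r_bounds[of n] by (simp, intro mult_left_mono) auto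
  then have "\<bar>1 - t\<bar> \<le> 2 + K\<^sup>2" using zero_le_power2[of K] unfolding mult_1_right abs_le_iff by linarith
  then have "\<bar>1 - (1 + K\<^sup>2) * r n\<bar> \<le> 2 + K\<^sup>2" unfolding t_def .
  then show ?thesis unfolding d2_def abs_mult by (rule mult_left_mono) simp
qed

lemma d3_eq: "d3 n = c3 * q n" by (simp add: d3_def c3_def)

lemma d3_bound: "\<bar>d3 n\<bar> \<le> \<bar>c3\<bar>"
  unfolding d3_eq abs_mult using q_pos[of n] q_le1[of n] by (simp add: mult_left_le)

lemma XY_square_bound:
  "(X H F n)\<^sup>2 \<le> 2 * D\<^sup>2 * ((H n)\<^sup>2 + (F n)\<^sup>2)" "(Y H F n)\<^sup>2 \<le> 2 * D\<^sup>2 * ((H n)\<^sup>2 + (F n)\<^sup>2)"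
proof -
  have gen: "(u * x + v * y)\<^sup>2 \<le> 2 * D\<^sup>2 * (x\<^sup>2 + y\<^sup>2)" if "\<bar>u\<bar> \<le> D" "\<bar>v\<bar> \<le> D" for u v x y :: real
  proof -
    have "(u * x + v * y)\<^sup>2 \<le> 2 * (u * x)\<^sup>2 + 2 * (v * y)\<^sup>2"
      using zero_le_power2[of "u * x - v * y"] unfolding power2_sum power2_diff by linarith
    also have "\<dots> = 2 * (u\<^sup>2 * x\<^sup>2) + 2 * (v\<^sup>2 * y\<^sup>2)" by (simp add: power_mult_distrib)
    also have "\<dots> \<le> 2 * (D\<^sup>2 * x\<^sup>2) + 2 * (D\<^sup>2 * y\<^sup>2)"
      using that by (intro add_mono mult_left_mono mult_right_mono) (auto simp: abs_le_square_iff[symmetric])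
    finally show ?thesis by (simp add: algebra_simps)
  qed
  have nn: "0 \<le> K\<^sup>2" "0 \<le> \<bar>a\<bar> * (2 + K\<^sup>2)" "0 \<le> \<bar>c3\<bar>" by auto
  show "(X H F n)\<^sup>2 \<le> 2 * D\<^sup>2 * ((H n)\<^sup>2 + (F n)\<^sup>2)"
    unfolding X_def using d1_bound[of n] d2_bound[of n] nn by (intro gen) (unfold D_def, linarith+)
  have "(d3 n * H n + 1 * F n)\<^sup>2 \<le> 2 * D\<^sup>2 * ((H n)\<^sup>2 + (F n)\<^sup>2)"
    using d3_bound[of n] nn by (intro gen) (unfold D_def, linarith+)
  then show "(Y H F n)\<^sup>2 \<le> 2 * D\<^sup>2 * ((H n)\<^sup>2 + (F n)\<^sup>2)" unfolding Y_def by simp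
qed

lemma galerkin_sum_le1:
  assumes "galerkin N l H F" "finite T"
  shows "(\<Sum>n\<in>T. (H n)\<^sup>2 + (F n)\<^sup>2) \<le> 1"
proof -
  let ?S = "{- int N..int N + 1}"
  have "(\<Sum>n\<in>T. (H n)\<^sup>2 + (F n)\<^sup>2) \<le> (\<Sum>n\<in>T \<union> ?S. (H n)\<^sup>2 + (F n)\<^sup>2)"
    using assms(2) by (intro sum_mono2) auto
  also have "\<dots> = (\<Sum>n\<in>?S. (H n)\<^sup>2 + (F n)\<^sup>2)"
    using assms unfolding galerkin_def by (intro sum.mono_neutral_right) auto
  also have "\<dots> = 1" using assms(1) unfolding galerkin_def by simp
  finally show ?thesis .
qed

text \<open>The energy estimate enters as the hypothesis \<open>bd\<close>, so that one argument
  serves both the unweighted case (\<open>R = 1\<close>) and the exponential weights. It is applied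
  twice: to \<open>F\<close> with source \<open>d3 H = c3 q H\<close>, then to \<open>H\<close> with
  source \<open>- K^2 q H + d2 F\<close>, where \<open>F\<close> has just been estimated. Only the
  energy of \<open>q H\<close> remains on the right.\<close>

lemma galerkin_weighted:
  fixes w :: "int \<Rightarrow> real"
  defines "E \<equiv> \<lambda>N A. \<Sum>n\<in>{- int N - 1..int N + 1 + 1}. (w n * A n)\<^sup>2"
  assumes G: "galerkin N l H F" and "R \<ge> 0"
    and bd: "\<And>A Z. (\<And>n. n \<notin> {- int N..int N + 1} \<Longrightarrow> A n = 0 \<and> Z n = 0) \<Longrightarrow>
      (\<And>n. n \<in> {- int N..int N + 1} \<Longrightarrow>
         l * A n = K / 2 * ((A (n + 1) + Z (n + 1)) - (A (n - 1) + Z (n - 1)))) \<Longrightarrow>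
      E N A \<le> R * E N Z"
  shows "E N F \<le> R * c3\<^sup>2 * E N (\<lambda>n. q n * H n)"
    and "E N H \<le> R * (2 * K^4 + 2 * (a * (2 + K\<^sup>2))\<^sup>2 * (R * c3\<^sup>2)) * E N (\<lambda>n. q n * H n)"
proof -
  have out: "H n = 0" "F n = 0" if "n \<notin> {- int N..int N + 1}" for n
    using G that unfolding galerkin_def by auto
  have eqH: "l * H n = K / 2 * (X H F (n + 1) - X H F (n - 1))"
    and eqF: "l * F n = K / 2 * (Y H F (n + 1) - Y H F (n - 1))" if "n \<in> {- int N..int N + 1}" for n
    using G that unfolding galerkin_def by auto
  have "E N F \<le> R * E N (\<lambda>n. d3 n * H n)"
    by (rule bd) (auto simp: out eqF Y_def)
  also have "E N (\<lambda>n. d3 n * H n) = c3\<^sup>2 * E N (\<lambda>n. q n * H n)"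
    unfolding E_def sum_distrib_left by (intro sum.cong) (auto simp: d3_eq power_mult_distrib)
  finally show F: "E N F \<le> R * c3\<^sup>2 * E N (\<lambda>n. q n * H n)" by simp
  have H: "E N H \<le> R * E N (\<lambda>n. - (K\<^sup>2 * q n * H n) + d2 n * F n)"
    by (rule bd) (auto simp: out eqH X_def d1_def algebra_simps)
  have "E N (\<lambda>n. - (K\<^sup>2 * q n * H n) + d2 n * F n) \<le>
     2 * K^4 * E N (\<lambda>n. q n * H n) + 2 * (a * (2 + K\<^sup>2))\<^sup>2 * E N F"
    unfolding E_def sum_distrib_left sum.distrib[symmetric]
  proof (rule sum_mono)
    fix n
    have "(w n * (- (K\<^sup>2 * q n * H n) + d2 n * F n))\<^sup>2 = (- (K\<^sup>2 * (w n * (q n * H n))) + d2 n * (w n * F n))\<^sup>2"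
      by (simp add: algebra_simps)
    also have "\<dots> \<le> 2 * (K\<^sup>2 * (w n * (q n * H n)))\<^sup>2 + 2 * (d2 n * (w n * F n))\<^sup>2"
      using zero_le_power2[of "K\<^sup>2 * (w n * (q n * H n)) + d2 n * (w n * F n)"]
      unfolding power2_sum power2_minus by (simp add: algebra_simps)
    also have "\<dots> = 2 * K^4 * (w n * (q n * H n))\<^sup>2 + 2 * (d2 n)\<^sup>2 * (w n * F n)\<^sup>2"
      by (simp add: power_mult_distrib)
    also have "(d2 n)\<^sup>2 \<le> (a * (2 + K\<^sup>2))\<^sup>2"
      using d2_bound[of n] by (simp add: abs_le_square_iff[symmetric] abs_mult)
    then have "2 * (d2 n)\<^sup>2 * (w n * F n)\<^sup>2 \<le> 2 * (a * (2 + K\<^sup>2))\<^sup>2 * (w n * F n)\<^sup>2"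
      by (intro mult_right_mono mult_left_mono) auto
    finally show "(w n * (- (K\<^sup>2 * q n * H n) + d2 n * F n))\<^sup>2 \<le>
      2 * K^4 * (w n * (q n * H n))\<^sup>2 + 2 * (a * (2 + K\<^sup>2))\<^sup>2 * (w n * F n)\<^sup>2" by simp
  qed
  also have "2 * (a * (2 + K\<^sup>2))\<^sup>2 * E N F \<le> 2 * (a * (2 + K\<^sup>2))\<^sup>2 * (R * c3\<^sup>2 * E N (\<lambda>n. q n * H n))"
    by (intro mult_left_mono F) auto
  finally have "R * E N (\<lambda>n. - (K\<^sup>2 * q n * H n) + d2 n * F n) \<le> R * (2 * K^4 * E N (\<lambda>n. q n * H n) +
      2 * (a * (2 + K\<^sup>2))\<^sup>2 * (R * c3\<^sup>2 * E N (\<lambda>n. q n * H n)))"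
    using \<open>R \<ge> 0\<close> by (simp add: mult_left_mono)
  then show "E N H \<le> R * (2 * K^4 + 2 * (a * (2 + K\<^sup>2))\<^sup>2 * (R * c3\<^sup>2)) * E N (\<lambda>n. q n * H n)"
    using H by (simp add: algebra_simps)
qed

text \<open>The multiplier \<open>q\<close> is at most 1 everywhere and at most
  \<open>1 / (1 + m)\<close> beyond mode \<open>m\<close>. This is a quantitative form of its
  compactness: the high modes enter only with a small factor.\<close>

lemma low_high_split:
  assumes "finite J"
  shows "(\<Sum>n\<in>J. (w n * (q n * H n))\<^sup>2) \<le>
    (\<Sum>n\<in>{- int m..int m}. (w n * H n)\<^sup>2) + (1 / (1 + real m))\<^sup>2 * (\<Sum>n\<in>J. (w n * H n)\<^sup>2)"
proof -
  have "(\<Sum>n\<in>J. (w n * (q n * H n))\<^sup>2) \<le>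
     (\<Sum>n\<in>J. (if n \<in> {- int m..int m} then (w n * H n)\<^sup>2 else 0) + (1 / (1 + real m))\<^sup>2 * (w n * H n)\<^sup>2)"
  proof (rule sum_mono)
    fix n
    have eq: "(w n * (q n * H n))\<^sup>2 = (q n)\<^sup>2 * (w n * H n)\<^sup>2" by (simp add: power_mult_distrib)
    show "(w n * (q n * H n))\<^sup>2 \<le> (if n \<in> {- int m..int m} then (w n * H n)\<^sup>2 else 0) + (1 / (1 + real m))\<^sup>2 * (w n * H n)\<^sup>2"
    proof (cases "n \<in> {- int m..int m}")
      case True
      have "(q n)\<^sup>2 * (w n * H n)\<^sup>2 \<le> 1 * (w n * H n)\<^sup>2"
        using q_pos[of n] q_le1[of n] by (intro mult_right_mono) (auto simp: power_le_one)
      then show ?thesis using True unfolding eq by (simp add: add_increasing2)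
    next
      case False
      then have "real m \<le> \<bar>of_int n\<bar>" "1 \<le> \<bar>of_int n :: real\<bar>" by auto
      then have "real m * 1 \<le> \<bar>of_int n\<bar> * \<bar>of_int n\<bar>" by (intro mult_mono) auto
      also have "\<dots> = 1 * (of_int n)\<^sup>2" by (simp add: power2_eq_square)
      also have "\<dots> \<le> K\<^sup>2 * (of_int n)\<^sup>2" using K2 by (intro mult_right_mono) (auto simp: one_le_power)
      finally have "1 + real m \<le> 1 + (K * of_int n)\<^sup>2" by (simp add: power_mult_distrib)
      then have "q n \<le> 1 / (1 + real m)" unfolding q_def by (intro divide_left_mono) (auto simp: add_pos_nonneg)
      then have "(q n)\<^sup>2 \<le> (1 / (1 + real m))\<^sup>2" using q_pos[of n] by (intro power_mono) auto
      then show ?thesis unfolding eq if_not_P[OF False] by (simp add: mult_right_mono)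
    qed
  qed
  also have "\<dots> = (\<Sum>n\<in>J \<inter> {- int m..int m}. (w n * H n)\<^sup>2) + (1 / (1 + real m))\<^sup>2 * (\<Sum>n\<in>J. (w n * H n)\<^sup>2)"
    using assms by (simp add: sum.distrib sum_distrib_left sum.inter_restrict)
  also have "(\<Sum>n\<in>J \<inter> {- int m..int m}. (w n * H n)\<^sup>2) \<le> (\<Sum>n\<in>{- int m..int m}. (w n * H n)\<^sup>2)"
    by (intro sum_mono2) auto
  finally show ?thesis by simp
qed

lemma tail_small:
  assumes "C \<ge> 0"
  obtains m :: nat where "C * (1 / (1 + real m))\<^sup>2 \<le> 1 / 2"
proof -
  obtain m :: nat where m: "2 * C \<le> real m" using real_arch_simple by blast
  have "2 * C \<le> (1 + real m) * 1" using m by simp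
  also have "\<dots> \<le> (1 + real m) * (1 + real m)" by (intro mult_left_mono) auto
  finally have "C / ((1 + real m) * (1 + real m)) \<le> 1 / 2" by (subst pos_divide_le_eq) auto
  then have "C * (1 / (1 + real m))\<^sup>2 \<le> 1 / 2" by (simp add: power2_eq_square)
  then show ?thesis by (rule that)
qed

text \<open>The unit mass of the truncated eigenvectors cannot escape to high modes: it is at most
  \<open>C\<close> times the energy of \<open>q H\<close>, of which the modes beyond
  \<open>m\<close> account for at most 1/2. Neither \<open>m\<close> nor \<open>\<delta>\<close>
  depends on \<open>N\<close> or \<open>l\<close>, which is what makes the limit nonzero.\<close>

lemma galerkin_low_mass:
  obtains m :: nat and \<delta> :: real where "\<delta> > 0"
    "\<And>N l H F. galerkin N l H F \<Longrightarrow> \<delta> \<le> (\<Sum>n\<in>{- int m..int m}. (H n)\<^sup>2)"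
proof -
  \<comment> \<open>The sum of the two constants of \<open>galerkin_weighted\<close> for
    \<open>R = 1\<close>, since the mass counts both \<open>H\<close> and \<open>F\<close>.\<close>
  define C where "C = c3\<^sup>2 + (2 * K^4 + 2 * (a * (2 + K\<^sup>2))\<^sup>2 * c3\<^sup>2)"
  have "K^4 > 0" using K2 by simp
  moreover have "0 \<le> c3\<^sup>2" "0 \<le> 2 * (a * (2 + K\<^sup>2))\<^sup>2 * c3\<^sup>2" by auto
  ultimately have "C > 0" unfolding C_def by linarith
  then obtain m :: nat where m: "C * (1 / (1 + real m))\<^sup>2 \<le> 1 / 2" using tail_small[of C] by auto
  have "1 / (2 * C) \<le> (\<Sum>n\<in>{- int m..int m}. (H n)\<^sup>2)" if G: "galerkin N l H F" for N l H F
  proof -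
    let ?J = "{- int N - 1..int N + 1 + 1}"
    let ?q = "\<Sum>n\<in>?J. (q n * H n)\<^sup>2"
    have l: "l > 0" using G unfolding galerkin_def by simp
    have bd: "(\<Sum>n\<in>?J. (1 * A n)\<^sup>2) \<le> 1 * (\<Sum>n\<in>?J. (1 * Z n)\<^sup>2)"
      if "\<And>n. n \<notin> {- int N..int N + 1} \<Longrightarrow> A n = 0 \<and> Z n = 0"
        "\<And>n. n \<in> {- int N..int N + 1} \<Longrightarrow>
         l * A n = K / 2 * ((A (n + 1) + Z (n + 1)) - (A (n - 1) + Z (n - 1)))" for A Z
      unfolding mult_1_left by (rule skew_energy_bound[OF _ l, where c = "K / 2"]) (fact that)+
    have "(\<Sum>n\<in>?J. (F n)\<^sup>2) \<le> c3\<^sup>2 * ?q"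
      "(\<Sum>n\<in>?J. (H n)\<^sup>2) \<le> (2 * K^4 + 2 * (a * (2 + K\<^sup>2))\<^sup>2 * c3\<^sup>2) * ?q"
      using galerkin_weighted[OF G _ bd] by simp_all
    moreover have "1 = (\<Sum>n\<in>?J. (H n)\<^sup>2 + (F n)\<^sup>2)"
    proof -
      have "(\<Sum>n\<in>?J. (H n)\<^sup>2 + (F n)\<^sup>2) = (\<Sum>n\<in>{- int N..int N + 1}. (H n)\<^sup>2 + (F n)\<^sup>2)"
        using G unfolding galerkin_def by (intro sum.mono_neutral_right) auto
      then show ?thesis using G unfolding galerkin_def by simp
    qed
    ultimately have 1: "1 \<le> C * ?q" unfolding C_def sum.distrib by (simp add: algebra_simps)
    have "(\<Sum>n\<in>?J. (H n)\<^sup>2) \<le> (\<Sum>n\<in>?J. (H n)\<^sup>2 + (F n)\<^sup>2)" by (intro sum_mono) auto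
    then have le1: "(\<Sum>n\<in>?J. (H n)\<^sup>2) \<le> 1" using galerkin_sum_le1[OF G, of ?J] by simp
    have "?q \<le> (\<Sum>n\<in>{- int m..int m}. (H n)\<^sup>2) + (1 / (1 + real m))\<^sup>2 * (\<Sum>n\<in>?J. (H n)\<^sup>2)"
      using low_high_split[of ?J "\<lambda>_. 1" H m] by simp
    also have "\<dots> \<le> (\<Sum>n\<in>{- int m..int m}. (H n)\<^sup>2) + (1 / (1 + real m))\<^sup>2 * 1"
      using le1 by (intro add_left_mono mult_left_mono) auto
    finally have "C * ?q \<le> C * ((\<Sum>n\<in>{- int m..int m}. (H n)\<^sup>2) + (1 / (1 + real m))\<^sup>2 * 1)"
      using \<open>C > 0\<close> by (intro mult_left_mono) auto
    then have "1 / 2 \<le> C * (\<Sum>n\<in>{- int m..int m}. (H n)\<^sup>2)"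
      using 1 m by (simp add: distrib_left)
    then show ?thesis using \<open>C > 0\<close> by (simp add: field_simps)
  qed
  then show ?thesis using \<open>C > 0\<close> by (intro that[of "1 / (2 * C)" m]) auto
qed

text \<open>The growing weight is put on the truncations and not on the limit: they have finite
  support, so the weighted energies are finite beforehand and may be absorbed. The constants depend
  on \<open>l\<close> but not on \<open>N\<close>, so the bound passes to the limit.\<close>

lemma galerkin_decay:
  assumes l: "l > 0"
  obtains \<rho> B :: real where "\<rho> > 1"
    "\<And>N l' H F n. galerkin N l' H F \<Longrightarrow> l \<le> l' \<Longrightarrow>
       (\<rho> ^ nat \<bar>n\<bar> * H n)\<^sup>2 \<le> B \<and> (\<rho> ^ nat \<bar>n\<bar> * F n)\<^sup>2 \<le> B"
proof -
  \<comment> \<open>Neighbouring weights differ by a factor \<open>\<rho>\<close>, so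
    \<open>\<epsilon> = \<rho> - 1 / \<rho>\<close> is the exact constant of the commutator. It is
    at most \<open>2 * (\<rho> - 1)\<close>, and \<open>\<rho>\<close> is chosen to make
    \<open>K / 2\<close> times this equal to \<open>l / 2\<close>.\<close>
  define \<rho> where "\<rho> = 1 + l / (2 * K)"
  have \<rho>: "\<rho> > 1" using l K2 by (simp add: \<rho>_def)
  define \<epsilon> where "\<epsilon> = \<rho> - 1 / \<rho>"
  have "\<epsilon> \<le> 2 * (\<rho> - 1)" using \<rho> zero_le_power2[of "\<rho> - 1"]
    unfolding power2_diff by (simp add: \<epsilon>_def field_simps power2_eq_square)
  then have "K / 2 * \<epsilon> \<le> K / 2 * (2 * (\<rho> - 1))" using K2 by (intro mult_left_mono) auto
  also have "\<dots> = l / 2" using K2 by (simp add: \<rho>_def)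
  finally have \<epsilon>: "K / 2 * \<epsilon> \<le> l / 2" .
  define w :: "int \<Rightarrow> real" where "w n = \<rho> ^ nat \<bar>n\<bar>" for n
  have wpos: "w n > 0" for n using \<rho> by (simp add: w_def)
  have step: "w (n + 1) = \<rho> * w n \<or> w n = \<rho> * w (n + 1)" for n
  proof (cases "n \<ge> 0")
    case True
    then have *: "nat \<bar>n + 1\<bar> = Suc (nat \<bar>n\<bar>)" by simp
    show ?thesis unfolding w_def * by simp
  next
    case False
    then have *: "nat \<bar>n\<bar> = Suc (nat \<bar>n + 1\<bar>)" by simp
    show ?thesis unfolding w_def * by simp
  qed
  have grow: "x \<le> \<rho> * (\<rho> * x)" if "x > 0" for x
  proof -
    have "1 * 1 \<le> \<rho> * \<rho>" using \<rho> by (intro mult_mono) auto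
    then show ?thesis using that by (simp flip: mult.assoc)
  qed
  have ratio: "w n \<le> \<rho> * w (n + 1)" "w (n + 1) \<le> \<rho> * w n" for n
    using step[of n] grow[OF wpos[of n]] grow[OF wpos[of "n + 1"]] by auto
  have diff: "\<bar>(w n)\<^sup>2 - (w (n + 1))\<^sup>2\<bar> \<le> \<epsilon> * (w n * w (n + 1))" for n
  proof -
    have *: "\<bar>x\<^sup>2 - (\<rho> * x)\<^sup>2\<bar> = \<epsilon> * (x * (\<rho> * x))" for x :: real
    proof -
      have "x\<^sup>2 \<le> \<rho>\<^sup>2 * x\<^sup>2" using \<rho> by (intro mult_right_mono[of 1 "\<rho>\<^sup>2", simplified]) (auto simp: one_le_power)
      then show ?thesis using \<rho> unfolding power_mult_distrib
        by (simp add: \<epsilon>_def field_simps power2_eq_square)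
    qed
    show ?thesis using step[of n] *[of "w n"] *[of "w (n + 1)"]
      by (auto simp: abs_minus_commute mult.commute)
  qed
  define R where "R = 16 * (K / 2)\<^sup>2 * \<rho>\<^sup>2 / l\<^sup>2"
  have R: "R \<ge> 0" by (simp add: R_def)
  define C where "C = R * (2 * K^4 + 2 * (a * (2 + K\<^sup>2))\<^sup>2 * (R * c3\<^sup>2))"
  have C: "C \<ge> 0" using R by (simp add: C_def)
  obtain m :: nat where m: "C * (1 / (1 + real m))\<^sup>2 \<le> 1 / 2" using tail_small[OF C] .
  \<comment> \<open>The low modes contribute at most \<open>(w (int m))^2\<close>, because the total
    mass is 1. Then \<open>EH <= C * (w (int m))^2 + EH / 2\<close>, whence the factor 2.\<close>
  define BH where "BH = 2 * C * (w (int m))\<^sup>2"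
  define B where "B = max BH (R * c3\<^sup>2 * BH)"
  have "(w n * H n)\<^sup>2 \<le> B \<and> (w n * F n)\<^sup>2 \<le> B" if G: "galerkin N l' H F" and ll: "l \<le> l'" for N l' H F n
  proof -
    let ?J = "{- int N - 1..int N + 1 + 1}"
    have bd: "(\<Sum>n\<in>?J. (w n * A n)\<^sup>2) \<le> R * (\<Sum>n\<in>?J. (w n * Z n)\<^sup>2)"
      if "\<And>n. n \<notin> {- int N..int N + 1} \<Longrightarrow> A n = 0 \<and> Z n = 0"
        "\<And>n. n \<in> {- int N..int N + 1} \<Longrightarrow>
         l' * A n = K / 2 * ((A (n + 1) + Z (n + 1)) - (A (n - 1) + Z (n - 1)))" for A Z
      unfolding R_def
      by (rule weighted_energy_bound[where \<epsilon> = \<epsilon> and l' = l'])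
        (fact that l ll wpos ratio diff \<epsilon> | use K2 in simp)+
    define EH where "EH = (\<Sum>n\<in>?J. (w n * H n)\<^sup>2)"
    define EF where "EF = (\<Sum>n\<in>?J. (w n * F n)\<^sup>2)"
    define Eq where "Eq = (\<Sum>n\<in>?J. (w n * (q n * H n))\<^sup>2)"
    have F: "EF \<le> R * c3\<^sup>2 * Eq" and H: "EH \<le> C * Eq"
      using galerkin_weighted[where w=w, OF G R bd] unfolding EH_def EF_def Eq_def C_def by auto
    have "(\<Sum>n\<in>{- int m..int m}. (w n * H n)\<^sup>2) \<le> (\<Sum>n\<in>{- int m..int m}. (w (int m))\<^sup>2 * ((H n)\<^sup>2 + (F n)\<^sup>2))"
    proof (rule sum_mono)
      fix n assume n: "n \<in> {- int m..int m}"
      then have "w n \<le> w (int m)" unfolding w_def using \<rho> by (intro power_increasing) auto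
      then show "(w n * H n)\<^sup>2 \<le> (w (int m))\<^sup>2 * ((H n)\<^sup>2 + (F n)\<^sup>2)"
        unfolding power_mult_distrib using wpos[of n] by (intro mult_mono power_mono) auto
    qed
    also have "\<dots> \<le> (w (int m))\<^sup>2 * 1"
      unfolding sum_distrib_left[symmetric] by (intro mult_left_mono galerkin_sum_le1[OF G]) auto
    finally have low: "(\<Sum>n\<in>{- int m..int m}. (w n * H n)\<^sup>2) \<le> (w (int m))\<^sup>2" by simp
    have "Eq \<le> (w (int m))\<^sup>2 + (1 / (1 + real m))\<^sup>2 * EH"
      using low_high_split[of ?J w H m] low unfolding Eq_def EH_def by simp
    then have "C * Eq \<le> C * ((w (int m))\<^sup>2 + (1 / (1 + real m))\<^sup>2 * EH)" using C by (rule mult_left_mono)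
    also have "\<dots> = C * (w (int m))\<^sup>2 + (C * (1 / (1 + real m))\<^sup>2) * EH" by (simp add: distrib_left)
    also have "\<dots> \<le> C * (w (int m))\<^sup>2 + 1 / 2 * EH"
      using m by (intro add_left_mono mult_right_mono) (auto simp: EH_def sum_nonneg)
    finally have EH: "EH \<le> BH" using H unfolding BH_def by linarith
    have "Eq \<le> EH" unfolding Eq_def EH_def
    proof (rule sum_mono)
      fix n
      have "(q n)\<^sup>2 * (w n * H n)\<^sup>2 \<le> 1 * (w n * H n)\<^sup>2"
        using q_pos[of n] q_le1[of n] by (intro mult_right_mono) (auto simp: power_le_one)
      then show "(w n * (q n * H n))\<^sup>2 \<le> (w n * H n)\<^sup>2" by (simp add: power_mult_distrib mult_ac)
    qed
    then have "R * c3\<^sup>2 * Eq \<le> R * c3\<^sup>2 * BH" using EH R by (intro mult_left_mono) auto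
    then have EF: "EF \<le> R * c3\<^sup>2 * BH" using F by linarith
    have "0 \<le> BH" using C by (simp add: BH_def)
    show ?thesis
    proof (cases "n \<in> ?J")
      case True
      then have "(w n * H n)\<^sup>2 \<le> EH" "(w n * F n)\<^sup>2 \<le> EF"
        unfolding EH_def EF_def by (auto intro!: member_le_sum)
      then show ?thesis using EH EF unfolding B_def by linarith
    next
      case False
      then have "H n = 0" "F n = 0" using G unfolding galerkin_def by auto
      then show ?thesis using \<open>0 \<le> BH\<close> unfolding B_def by simp
    qed
  qed
  then show ?thesis using that[OF \<rho>] unfolding w_def by blast
qed

end

subsection \<open>Passage to the limit\<close>

context imhd
begin

lemma mode_recurrence:
  obtains l \<sigma> :: real and H :: "int \<Rightarrow> real" and B :: real and F :: "int \<Rightarrow> real" where "l > 0" "0 < \<sigma>" "\<sigma> < 1"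
    "\<And>n. \<bar>H n\<bar> \<le> B * \<sigma> ^ nat \<bar>n\<bar>" "\<And>n. \<bar>F n\<bar> \<le> B * \<sigma> ^ nat \<bar>n\<bar>"
    "\<And>n. l * H n = K / 2 * (X H F (n + 1) - X H F (n - 1))"
    "\<And>n. l * F n = K / 2 * (Y H F (n + 1) - Y H F (n - 1))"
    "\<exists>n. H n \<noteq> 0"
proof -
  obtain l H F where G: "\<And>N. galerkin N (l N) (H N) (F N)"
    using galerkin_exists by metis
  obtain m :: nat and \<delta> where \<delta>: "\<delta> > 0" and low: "\<And>N. \<delta> \<le> (\<Sum>n\<in>{- int m..int m}. (H N n)\<^sup>2)"
    using galerkin_low_mass G by metis
  have le1: "(H N n)\<^sup>2 + (F N n)\<^sup>2 \<le> 1" for N n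
    using galerkin_sum_le1[OF G, of "{n}" N] by simp
  have lpos: "l N > 0" for N using G[of N] unfolding galerkin_def by simp
  have D2: "0 \<le> D\<^sup>2" by simp
  \<comment> \<open>Upper bound for the eigenvalues: each \<open>l N * H N n\<close> is bounded
    through the recurrence, while the low modes carry mass at least \<open>\<delta>\<close>, so
    \<open>l N\<close> cannot become large.\<close>
  have lH: "(l N * H N n)\<^sup>2 \<le> 2 * K\<^sup>2 * D\<^sup>2" for N n
  proof (cases "n \<in> {- int N..int N + 1}")
    case True
    let ?u = "X (H N) (F N) (n + 1)" and ?v = "X (H N) (F N) (n - 1)"
    have b: "(X (H N) (F N) j)\<^sup>2 \<le> 2 * D\<^sup>2" for j
      using XY_square_bound(1)[of "H N" "F N" j] mult_left_mono[OF le1[of N j], of "2 * D\<^sup>2"] D2 by linarith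
    have "(?u - ?v)\<^sup>2 \<le> 2 * ?u\<^sup>2 + 2 * ?v\<^sup>2"
      using zero_le_power2[of "?u + ?v"] unfolding power2_sum power2_diff by linarith
    also have "\<dots> \<le> 8 * D\<^sup>2" using b[of "n + 1"] b[of "n - 1"] by linarith
    finally have "(K / 2)\<^sup>2 * (?u - ?v)\<^sup>2 \<le> (K / 2)\<^sup>2 * (8 * D\<^sup>2)" by (intro mult_left_mono) auto
    moreover have "l N * H N n = K / 2 * (?u - ?v)" using G[of N] True unfolding galerkin_def by auto
    then have "(l N * H N n)\<^sup>2 = (K / 2)\<^sup>2 * (?u - ?v)\<^sup>2" by (simp only: power_mult_distrib)
    moreover have "(K / 2)\<^sup>2 * (8 * D\<^sup>2) = 2 * K\<^sup>2 * D\<^sup>2" by (simp add: power_divide)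
    ultimately show ?thesis by linarith
  next
    case False
    then have "H N n = 0" using G[of N] unfolding galerkin_def by auto
    then show ?thesis by simp
  qed
  have "(l N)\<^sup>2 * \<delta> \<le> real (2 * m + 1) * (2 * K\<^sup>2 * D\<^sup>2)" for N
  proof -
    have "(l N)\<^sup>2 * \<delta> \<le> (l N)\<^sup>2 * (\<Sum>n\<in>{- int m..int m}. (H N n)\<^sup>2)"
      using low by (intro mult_left_mono) auto
    also have "\<dots> = (\<Sum>n\<in>{- int m..int m}. (l N * H N n)\<^sup>2)"
      by (simp add: sum_distrib_left power_mult_distrib)
    also have "\<dots> \<le> (\<Sum>n\<in>{- int m..int m}. 2 * K\<^sup>2 * D\<^sup>2)" by (intro sum_mono lH)
    also have "\<dots> = real (2 * m + 1) * (2 * K\<^sup>2 * D\<^sup>2)" by (simp add: nat_add_distrib)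
    finally show ?thesis .
  qed
  then have l2: "(l N)\<^sup>2 \<le> real (2 * m + 1) * (2 * K\<^sup>2 * D\<^sup>2) / \<delta>" for N
    using \<delta> by (simp add: pos_le_divide_eq)
  define L where "L = sqrt (real (2 * m + 1) * (2 * K\<^sup>2 * D\<^sup>2) / \<delta>)"
  have lL: "l N \<le> L" for N unfolding L_def by (rule real_le_rsqrt[OF l2])
  have "(H N n)\<^sup>2 \<le> 1" "(F N n)\<^sup>2 \<le> 1" for N n
    using le1[of N n] zero_le_power2[of "H N n"] zero_le_power2[of "F N n"] by linarith+
  then have HF1: "\<bar>H N n\<bar> \<le> 1" "\<bar>F N n\<bar> \<le> 1" for N n by (simp_all add: abs_square_le_1)
  have bound: "norm (l N, H N n, F N n) \<le> L + 2" for N n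
    using norm_Pair_le[of "l N" "(H N n, F N n)"] norm_Pair_le[of "H N n" "F N n"] lL[of N] lpos[of N]
      HF1[of N n] unfolding real_norm_def by linarith
  \<comment> \<open>The eigenvalue is repeated in the triple at every index, so a single diagonal
    extraction makes it converge together with all coefficients.\<close>
  have "\<exists>s. strict_mono s \<and> (\<forall>n. \<exists>z. (\<lambda>j. (l (s j), H (s j) n, F (s j) n)) \<longlonglongrightarrow> z)"
    by (rule function_convergent_subsequence[of "UNIV :: int set" "\<lambda>N n. (l N, H N n, F N n)" "L + 2"])
      (use bound in blast)+
  then obtain s :: "nat \<Rightarrow> nat" where s: "strict_mono s"
    "\<And>n. \<exists>z. (\<lambda>j. (l (s j), H (s j) n, F (s j) n)) \<longlonglongrightarrow> z" by blast
  then obtain z where z: "\<And>n::int. (\<lambda>j. (l (s j), H (s j) n, F (s j) n)) \<longlonglongrightarrow> z n" by metis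
  define l' where "l' = fst (z 0)"
  define H' where "H' n = fst (snd (z n))" for n
  define F' where "F' n = snd (snd (z n))" for n
  have liml: "(\<lambda>j. l (s j)) \<longlonglongrightarrow> l'" using tendsto_fst[OF z[of 0]] by (simp add: l'_def)
  have limH: "(\<lambda>j. H (s j) n) \<longlonglongrightarrow> H' n" for n using tendsto_fst[OF tendsto_snd[OF z[of n]]] by (simp add: H'_def)
  have limF: "(\<lambda>j. F (s j) n) \<longlonglongrightarrow> F' n" for n using tendsto_snd[OF tendsto_snd[OF z[of n]]] by (simp add: F'_def)
  have limX: "(\<lambda>j. X (H (s j)) (F (s j)) n) \<longlonglongrightarrow> X H' F' n" for n
    unfolding X_def by (intro tendsto_intros limH limF)
  have limY: "(\<lambda>j. Y (H (s j)) (F (s j)) n) \<longlonglongrightarrow> Y H' F' n" for n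
    unfolding Y_def by (intro tendsto_intros limH limF)
  have ev: "\<forall>\<^sub>F j in sequentially. n \<in> {- int (s j)..int (s j) + 1}" for n
  proof -
    have "n \<in> {- int (s j)..int (s j) + 1}" if "j \<ge> nat \<bar>n\<bar>" for j
      using seq_suble[OF s(1), of j] that by auto
    then show ?thesis by (auto simp: eventually_sequentially)
  qed
  have eqH: "l' * H' n = K / 2 * (X H' F' (n + 1) - X H' F' (n - 1))" for n
  proof (rule tendsto_unique[OF trivial_limit_sequentially])
    show "(\<lambda>j. l (s j) * H (s j) n) \<longlonglongrightarrow> l' * H' n" by (intro tendsto_intros liml limH)
    have "(\<lambda>j. K / 2 * (X (H (s j)) (F (s j)) (n + 1) - X (H (s j)) (F (s j)) (n - 1)))
       \<longlonglongrightarrow> K / 2 * (X H' F' (n + 1) - X H' F' (n - 1))" by (intro tendsto_intros limX)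
    then show "(\<lambda>j. l (s j) * H (s j) n) \<longlonglongrightarrow> K / 2 * (X H' F' (n + 1) - X H' F' (n - 1))"
      by (rule Lim_transform_eventually) (use ev[of n] G in \<open>auto elim!: eventually_mono simp: galerkin_def\<close>)
  qed
  have eqF: "l' * F' n = K / 2 * (Y H' F' (n + 1) - Y H' F' (n - 1))" for n
  proof (rule tendsto_unique[OF trivial_limit_sequentially])
    show "(\<lambda>j. l (s j) * F (s j) n) \<longlonglongrightarrow> l' * F' n" by (intro tendsto_intros liml limF)
    have "(\<lambda>j. K / 2 * (Y (H (s j)) (F (s j)) (n + 1) - Y (H (s j)) (F (s j)) (n - 1)))
       \<longlonglongrightarrow> K / 2 * (Y H' F' (n + 1) - Y H' F' (n - 1))" by (intro tendsto_intros limY)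
    then show "(\<lambda>j. l (s j) * F (s j) n) \<longlonglongrightarrow> K / 2 * (Y H' F' (n + 1) - Y H' F' (n - 1))"
      by (rule Lim_transform_eventually) (use ev[of n] G in \<open>auto elim!: eventually_mono simp: galerkin_def\<close>)
  qed
  have "\<delta> \<le> (\<Sum>n\<in>{- int m..int m}. (H' n)\<^sup>2)"
  proof (rule tendsto_lowerbound)
    show "(\<lambda>j. \<Sum>n\<in>{- int m..int m}. (H (s j) n)\<^sup>2) \<longlonglongrightarrow> (\<Sum>n\<in>{- int m..int m}. (H' n)\<^sup>2)"
      by (intro tendsto_intros limH)
  qed (use low in auto)
  then have "(\<Sum>n\<in>{- int m..int m}. (H' n)\<^sup>2) \<noteq> 0" using \<delta> by linarith
  then have nz: "\<exists>n. H' n \<noteq> 0" by (metis sum.neutral zero_power2)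
  have sum1: "(\<Sum>n\<in>T. (H' n)\<^sup>2 + (F' n)\<^sup>2) \<le> 1" if "finite T" for T
  proof (rule tendsto_upperbound)
    show "(\<lambda>j. \<Sum>n\<in>T. (H (s j) n)\<^sup>2 + (F (s j) n)\<^sup>2) \<longlonglongrightarrow> (\<Sum>n\<in>T. (H' n)\<^sup>2 + (F' n)\<^sup>2)"
      by (intro tendsto_intros limH limF)
  qed (use galerkin_sum_le1[OF G that] in auto)
  have "l' \<ge> 0" by (rule tendsto_lowerbound[OF liml]) (auto intro!: always_eventually less_imp_le lpos)
  \<comment> \<open>For a vanishing eigenvalue the recurrence makes \<open>X\<close> and \<open>Y\<close> two-periodic and square summable,
    hence zero, and then the invertible symbol forces \<open>H\<close> and \<open>F\<close> to vanish.\<close>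
  moreover have "l' \<noteq> 0"
  proof
    assume l0: "l' = 0"
    have sq: "(\<Sum>n\<in>T. (X H' F' n)\<^sup>2) \<le> 2 * D\<^sup>2" "(\<Sum>n\<in>T. (Y H' F' n)\<^sup>2) \<le> 2 * D\<^sup>2" if "finite T" for T
    proof -
      have "(\<Sum>n\<in>T. 2 * D\<^sup>2 * ((H' n)\<^sup>2 + (F' n)\<^sup>2)) \<le> 2 * D\<^sup>2 * 1"
        unfolding sum_distrib_left[symmetric] by (intro mult_left_mono sum1 that) auto
      moreover have "(\<Sum>n\<in>T. (X H' F' n)\<^sup>2) \<le> (\<Sum>n\<in>T. 2 * D\<^sup>2 * ((H' n)\<^sup>2 + (F' n)\<^sup>2))"
        "(\<Sum>n\<in>T. (Y H' F' n)\<^sup>2) \<le> (\<Sum>n\<in>T. 2 * D\<^sup>2 * ((H' n)\<^sup>2 + (F' n)\<^sup>2))"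
        by (intro sum_mono XY_square_bound)+
      ultimately show "(\<Sum>n\<in>T. (X H' F' n)\<^sup>2) \<le> 2 * D\<^sup>2" "(\<Sum>n\<in>T. (Y H' F' n)\<^sup>2) \<le> 2 * D\<^sup>2"
        by linarith+
    qed
    have X0: "X H' F' n = 0" for n
      by (rule two_periodic_square_summable_zero[OF _ sq(1)]) (use eqH l0 K2 in auto)
    have Y0: "Y H' F' n = 0" for n
      by (rule two_periodic_square_summable_zero[OF _ sq(2)]) (use eqF l0 K2 in auto)
    have "H' n = 0" for n
    proof -
      have "(d1 n - d2 n * d3 n) * H' n = X H' F' n - d2 n * Y H' F' n"
        by (simp add: X_def Y_def algebra_simps)
      then show ?thesis using X0 Y0 det_mode_nz[of n] by simp
    qed
    then show False using nz by blast
  qed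
  ultimately have l': "l' > 0" by simp
  \<comment> \<open>Since the limit eigenvalue is positive, all late truncations have eigenvalues at
    least \<open>l' / 2\<close>; one rate and one constant then serve them all.\<close>
  obtain \<rho> B where \<rho>: "\<rho> > 1" and dec: "\<And>N l1 H F n. galerkin N l1 H F \<Longrightarrow> l' / 2 \<le> l1 \<Longrightarrow>
       (\<rho> ^ nat \<bar>n\<bar> * H n)\<^sup>2 \<le> B \<and> (\<rho> ^ nat \<bar>n\<bar> * F n)\<^sup>2 \<le> B"
    using galerkin_decay[of "l' / 2"] l' by (metis half_gt_zero)
  have evl: "\<forall>\<^sub>F j in sequentially. l' / 2 \<le> l (s j)"
    using order_tendstoD(1)[OF liml, of "l' / 2"] l' by (auto elim: eventually_mono)
  have decay: "\<bar>x n\<bar> \<le> sqrt B * (1 / \<rho>) ^ nat \<bar>n\<bar>" if "(\<rho> ^ nat \<bar>n\<bar> * x n)\<^sup>2 \<le> B" for x :: "int \<Rightarrow> real" and n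
  proof -
    have "\<bar>\<rho> ^ nat \<bar>n\<bar> * x n\<bar> \<le> sqrt B" using that by (metis real_sqrt_abs real_sqrt_le_mono)
    then show ?thesis using \<rho> by (simp add: abs_mult power_divide field_simps)
  qed
  have "(\<rho> ^ nat \<bar>n\<bar> * H' n)\<^sup>2 \<le> B" for n
  proof (rule tendsto_upperbound)
    show "(\<lambda>j. (\<rho> ^ nat \<bar>n\<bar> * H (s j) n)\<^sup>2) \<longlonglongrightarrow> (\<rho> ^ nat \<bar>n\<bar> * H' n)\<^sup>2" by (intro tendsto_intros limH)
    show "\<forall>\<^sub>F j in sequentially. (\<rho> ^ nat \<bar>n\<bar> * H (s j) n)\<^sup>2 \<le> B"
      using evl by (rule eventually_mono) (use dec[OF G] in blast)
  qed simp
  moreover have "(\<rho> ^ nat \<bar>n\<bar> * F' n)\<^sup>2 \<le> B" for n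
  proof (rule tendsto_upperbound)
    show "(\<lambda>j. (\<rho> ^ nat \<bar>n\<bar> * F (s j) n)\<^sup>2) \<longlonglongrightarrow> (\<rho> ^ nat \<bar>n\<bar> * F' n)\<^sup>2" by (intro tendsto_intros limF)
    show "\<forall>\<^sub>F j in sequentially. (\<rho> ^ nat \<bar>n\<bar> * F (s j) n)\<^sup>2 \<le> B"
      using evl by (rule eventually_mono) (use dec[OF G] in blast)
  qed simp
  ultimately have "\<And>n. \<bar>H' n\<bar> \<le> sqrt B * (1 / \<rho>) ^ nat \<bar>n\<bar>"
    "\<And>n. \<bar>F' n\<bar> \<le> sqrt B * (1 / \<rho>) ^ nat \<bar>n\<bar>" by (auto intro: decay)
  moreover have "0 < 1 / \<rho>" "1 / \<rho> < 1" using \<rho> by simp_all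
  ultimately show ?thesis using that[of l' "1 / \<rho>" H' "sqrt B" F'] l' eqH eqF nz by blast
qed

end

subsection \<open>Fourier series with exponentially decaying coefficients\<close>

text \<open>This class is preserved by bounded multipliers, by the factor \<open>n\<close>
  (differentiation) and by index shifts (multiplication by the cosine), so all later operations stay
  inside it.\<close>

definition exp_decaying :: "(int \<Rightarrow> complex) \<Rightarrow> bool" where
  "exp_decaying c \<longleftrightarrow> (\<exists>B \<sigma>::real. 0 < \<sigma> \<and> \<sigma> < 1 \<and> (\<forall>n. norm (c n) \<le> B * \<sigma> ^ nat \<bar>n\<bar>))"

definition fourier_series :: "real \<Rightarrow> (int \<Rightarrow> complex) \<Rightarrow> real \<Rightarrow> complex" where
  "fourier_series \<kappa> c s = (\<Sum>\<^sub>\<infinity>n. c n * cis (\<kappa> * of_int n * s))"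

lemma summable_on_geometric_int:
  fixes \<sigma> :: real
  assumes "0 < \<sigma>" "\<sigma> < 1"
  shows "(\<lambda>n::int. \<sigma> ^ nat \<bar>n\<bar>) summable_on UNIV"
proof -
  have geo: "summable (\<lambda>n. \<sigma> ^ n)" using assms by (intro summable_geometric) auto
  have on_nat: "(\<lambda>n::nat. \<sigma> ^ n) summable_on UNIV" "(\<lambda>n::nat. \<sigma> ^ Suc n) summable_on UNIV"
    using geo assms by (auto intro!: norm_summable_imp_summable_on simp: norm_mult norm_power summable_mult)
  have pos: "(\<lambda>n::int. \<sigma> ^ nat \<bar>n\<bar>) summable_on range int"
    by (rule summable_on_reindex[THEN iffD2]) (use on_nat(1) in \<open>simp_all add: o_def\<close>)
  have Suc_eq: "(\<lambda>n::int. \<sigma> ^ nat \<bar>n\<bar>) \<circ> (\<lambda>n. - int n - 1) = (\<lambda>n. \<sigma> ^ Suc n)"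
  proof
    fix n
    have "nat \<bar>- int n - 1\<bar> = Suc n" by simp
    then show "((\<lambda>n::int. \<sigma> ^ nat \<bar>n\<bar>) \<circ> (\<lambda>n. - int n - 1)) n = \<sigma> ^ Suc n" unfolding o_def by (rule arg_cong)
  qed
  have neg: "(\<lambda>n::int. \<sigma> ^ nat \<bar>n\<bar>) summable_on range (\<lambda>n. - int n - 1)"
  proof (rule summable_on_reindex[THEN iffD2])
    show "((\<lambda>n::int. \<sigma> ^ nat \<bar>n\<bar>) \<circ> (\<lambda>n. - int n - 1)) summable_on UNIV"
      unfolding Suc_eq by (rule on_nat(2))
  qed (simp add: inj_on_def)
  have union: "(UNIV :: int set) = range int \<union> range (\<lambda>n. - int n - 1)"
  proof -
    have "n \<in> range int \<union> range (\<lambda>n. - int n - 1)" for n :: int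
    proof (cases "n \<ge> 0")
      case True
      then show ?thesis by (metis UnI1 nonneg_int_cases rangeI)
    next
      case False
      then have "n = - int (nat (- n - 1)) - 1" by simp
      then show ?thesis by blast
    qed
    then show ?thesis by blast
  qed
  have "range int \<inter> range (\<lambda>n. - int n - 1) = {}" by auto
  from summable_on_Un_disjoint[OF pos neg this] show ?thesis unfolding union .
qed

lemma exp_decaying_summable: "exp_decaying c \<Longrightarrow> (\<lambda>n. norm (c n)) summable_on UNIV"
proof -
  assume "exp_decaying c"
  then obtain B \<sigma> :: real where *: "0 < \<sigma>" "\<sigma> < 1" "\<And>n. norm (c n) \<le> B * \<sigma> ^ nat \<bar>n\<bar>"
    unfolding exp_decaying_def by blast
  have "(\<lambda>n::int. B * \<sigma> ^ nat \<bar>n\<bar>) summable_on UNIV"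
    by (intro summable_on_cmult_right summable_on_geometric_int *)
  then show "(\<lambda>n. norm (c n)) summable_on UNIV" by (rule Infinite_Sum.abs_summable_on_comparison_test') (rule *(3))
qed

lemma exp_decaying_bounded_mult:
  assumes "exp_decaying c" "\<And>n. norm (m n) \<le> M"
  shows "exp_decaying (\<lambda>n. m n * c n)"
proof -
  obtain B \<sigma> :: real where *: "0 < \<sigma>" "\<sigma> < 1" "\<And>n. norm (c n) \<le> B * \<sigma> ^ nat \<bar>n\<bar>"
    using assms(1) unfolding exp_decaying_def by blast
  have "norm (m n * c n) \<le> (M * B) * \<sigma> ^ nat \<bar>n\<bar>" for n
    using mult_mono[OF assms(2) *(3), of n] order_trans[OF norm_ge_zero assms(2)[of n]]
    by (simp add: norm_mult mult.assoc)
  then show ?thesis using * unfolding exp_decaying_def by blast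
qed

lemma exp_decaying_add:
  assumes "exp_decaying c" "exp_decaying d"
  shows "exp_decaying (\<lambda>n. c n + d n)"
proof -
  obtain B \<sigma> :: real where c: "0 < \<sigma>" "\<sigma> < 1" "\<And>n. norm (c n) \<le> B * \<sigma> ^ nat \<bar>n\<bar>"
    using assms(1) unfolding exp_decaying_def by blast
  obtain B' \<sigma>' :: real where d: "0 < \<sigma>'" "\<sigma>' < 1" "\<And>n. norm (d n) \<le> B' * \<sigma>' ^ nat \<bar>n\<bar>"
    using assms(2) unfolding exp_decaying_def by blast
  have B: "B \<ge> 0" "B' \<ge> 0"
    using order_trans[OF norm_ge_zero c(3)[of 0]] order_trans[OF norm_ge_zero d(3)[of 0]] by simp_all
  have "norm (c n + d n) \<le> (B + B') * max \<sigma> \<sigma>' ^ nat \<bar>n\<bar>" for n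
  proof -
    have "norm (c n + d n) \<le> B * \<sigma> ^ nat \<bar>n\<bar> + B' * \<sigma>' ^ nat \<bar>n\<bar>"
      using c(3)[of n] d(3)[of n] norm_triangle_ineq[of "c n" "d n"] by linarith
    also have "\<dots> \<le> B * max \<sigma> \<sigma>' ^ nat \<bar>n\<bar> + B' * max \<sigma> \<sigma>' ^ nat \<bar>n\<bar>"
      using B c(1) d(1) by (intro add_mono mult_left_mono power_mono) auto
    finally show ?thesis by (simp add: distrib_right)
  qed
  moreover have "0 < max \<sigma> \<sigma>'" "max \<sigma> \<sigma>' < 1" using c d by auto
  ultimately show ?thesis unfolding exp_decaying_def by blast
qed

text \<open>Writing \<open>\<sigma>\<close> as the square of \<open>\<tau>\<close> leaves one power
  \<open>\<tau>^|n|\<close> to beat the factor \<open>n\<close> and one to serve as the new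
  rate.\<close>

lemma exp_decaying_linear_mult:
  assumes "exp_decaying c"
  shows "exp_decaying (\<lambda>n. of_int n * c n)"
proof -
  obtain B \<sigma> :: real where *: "0 < \<sigma>" "\<sigma> < 1" "\<And>n. norm (c n) \<le> B * \<sigma> ^ nat \<bar>n\<bar>"
    using assms(1) unfolding exp_decaying_def by blast
  define \<tau> where "\<tau> = sqrt \<sigma>"
  have \<tau>: "0 < \<tau>" "\<tau> < 1" "\<sigma> = \<tau> * \<tau>" using * by (auto simp: \<tau>_def)
  have "Bseq (\<lambda>n. of_nat n * \<tau> ^ n)"
    using powser_times_n_limit_0[of \<tau>] \<tau> by (intro convergent_imp_Bseq convergentI[where L=0]) auto
  then obtain C where C: "\<And>n. norm (of_nat n * \<tau> ^ n) \<le> C" unfolding Bseq_def by blast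
  have "B \<ge> 0" using order_trans[OF norm_ge_zero *(3)[of 0]] by simp
  have "norm (of_int n * c n) \<le> (B * C) * \<tau> ^ nat \<bar>n\<bar>" for n
  proof -
    have "norm (of_int n * c n) = of_nat (nat \<bar>n\<bar>) * norm (c n)" by (simp add: norm_mult)
    also have "\<dots> \<le> of_nat (nat \<bar>n\<bar>) * (B * \<sigma> ^ nat \<bar>n\<bar>)" by (intro mult_left_mono *) auto
    also have "\<dots> = B * (of_nat (nat \<bar>n\<bar>) * \<tau> ^ nat \<bar>n\<bar>) * \<tau> ^ nat \<bar>n\<bar>"
      unfolding \<tau>(3) power_mult_distrib by simp
    also have "\<dots> \<le> B * C * \<tau> ^ nat \<bar>n\<bar>"
      using C[of "nat \<bar>n\<bar>"] \<tau> \<open>B \<ge> 0\<close> by (intro mult_right_mono mult_left_mono) auto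
    finally show ?thesis .
  qed
  then show ?thesis using \<tau> unfolding exp_decaying_def by blast
qed

lemma exp_decaying_shift:
  assumes "exp_decaying c" "j = 1 \<or> j = -1"
  shows "exp_decaying (\<lambda>n. c (n + j))"
proof -
  obtain B \<sigma> :: real where *: "0 < \<sigma>" "\<sigma> < 1" "\<And>n. norm (c n) \<le> B * \<sigma> ^ nat \<bar>n\<bar>"
    using assms(1) unfolding exp_decaying_def by blast
  have "B \<ge> 0" using order_trans[OF norm_ge_zero *(3)[of 0]] by simp
  have "norm (c (n + j)) \<le> (B / \<sigma>) * \<sigma> ^ nat \<bar>n\<bar>" for n
  proof -
    have "\<sigma> ^ Suc (nat \<bar>n + j\<bar>) \<le> \<sigma> ^ nat \<bar>n\<bar>" using * assms(2) by (intro power_decreasing) auto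
    then have "B * \<sigma> ^ nat \<bar>n + j\<bar> \<le> B * (\<sigma> ^ nat \<bar>n\<bar> / \<sigma>)"
      using * \<open>B \<ge> 0\<close> by (intro mult_left_mono) (auto simp: pos_le_divide_eq mult.commute)
    then show ?thesis using *(3)[of "n + j"] by simp
  qed
  then show ?thesis using * unfolding exp_decaying_def by blast
qed

lemma fourier_term_summable:
  assumes "exp_decaying c"
  shows "(\<lambda>n. c n * cis (\<kappa> * of_int n * s)) summable_on UNIV"
  by (rule abs_summable_summable) (simp add: norm_mult exp_decaying_summable[OF assms])

lemma cis_has_vector_derivative:
  "((\<lambda>s. cis (w * s)) has_vector_derivative \<i> * of_real w * cis (w * s)) (at s within T)"
proof -
  have "((\<lambda>z. exp (\<i> * of_real w * z)) has_field_derivative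
      \<i> * of_real w * exp (\<i> * of_real w * of_real s)) (at (of_real s))"
    by (auto intro!: derivative_eq_intros)
  from has_vector_derivative_real_field[OF this] show ?thesis
    by (simp add: cis_conv_exp mult.assoc has_vector_derivative_at_within)
qed

text \<open>Enumerating the integers by \<open>int_decode\<close> turns the unordered sum into an
  ordinary series. The M-test, applied to the differentiated terms, then justifies termwise
  differentiation.\<close>

lemma fourier_series_has_vector_derivative:
  assumes c: "exp_decaying c"
  shows "(fourier_series \<kappa> c has_vector_derivative
     fourier_series \<kappa> (\<lambda>n. \<i> * of_real \<kappa> * (of_int n * c n)) s) (at s)"
proof -
  define dc where "dc = (\<lambda>n. \<i> * of_real \<kappa> * (of_int n * c n))"
  have dc: "exp_decaying dc" unfolding dc_def
    by (rule exp_decaying_bounded_mult[where M = "\<bar>\<kappa>\<bar>"]) (auto simp: norm_mult intro: exp_decaying_linear_mult c)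
  define f where "f i s = c (int_decode i) * cis (\<kappa> * of_int (int_decode i) * s)" for i s
  define f' where "f' i s = dc (int_decode i) * cis (\<kappa> * of_int (int_decode i) * s)" for i s
  have sums: "(\<lambda>i. e (int_decode i) * cis (\<kappa> * of_int (int_decode i) * s)) sums fourier_series \<kappa> e s"
    if "exp_decaying e" for e s
  proof -
    have "((\<lambda>n. e n * cis (\<kappa> * of_int n * s)) has_sum fourier_series \<kappa> e s) UNIV"
      unfolding fourier_series_def by (rule has_sum_infsum[OF fourier_term_summable[OF that]])
    then show ?thesis
      by (rule has_sum_imp_sums[OF has_sum_reindex_bij_betw[OF bij_int_decode, THEN iffD2]])
  qed
  have "(\<lambda>i. norm (dc (int_decode i))) summable_on UNIV"
    using exp_decaying_summable[OF dc]
      summable_on_reindex_bij_betw[OF bij_int_decode, of "\<lambda>n. norm (dc n)"] by simp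
  then have "summable (\<lambda>i. norm (dc (int_decode i)))" by (rule summable_on_imp_summable)
  then have "uniform_limit UNIV (\<lambda>n s. \<Sum>i<n. f' i s) (\<lambda>s. \<Sum>i. f' i s) sequentially"
    by (intro Weierstrass_m_test) (auto simp: f'_def norm_mult)
  moreover have "(\<Sum>i. f' i s) = fourier_series \<kappa> dc s" for s
    using sums[OF dc] unfolding f'_def by (rule sums_unique[symmetric])
  ultimately have ul: "uniform_limit UNIV (\<lambda>n s. \<Sum>i<n. f' i s) (fourier_series \<kappa> dc) sequentially" by simp
  have "\<exists>g. \<forall>x\<in>UNIV. (\<lambda>n. f n x) sums (g x) \<and> (g has_derivative (\<lambda>h. h *\<^sub>R fourier_series \<kappa> dc x)) (at x within UNIV)"
  proof (rule has_derivative_series[where f' = "\<lambda>i x h. h *\<^sub>R f' i x" and x = 0])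
    fix n x
    have "(f n has_vector_derivative c (int_decode n) * (\<i> * of_real (\<kappa> * of_int (int_decode n)) *
        cis (\<kappa> * of_int (int_decode n) * x))) (at x)"
      unfolding f_def by (intro has_vector_derivative_mult_right cis_has_vector_derivative)
    also have "c (int_decode n) * (\<i> * of_real (\<kappa> * of_int (int_decode n)) *
        cis (\<kappa> * of_int (int_decode n) * x)) = f' n x"
      by (simp add: f'_def dc_def)
    finally have "(f n has_vector_derivative f' n x) (at x)" .
    then show "(f n has_derivative (\<lambda>h. h *\<^sub>R f' n x)) (at x within UNIV)"
      by (simp add: has_vector_derivative_def)
  next
    fix e :: real assume "e > 0"
    show "\<forall>\<^sub>F n in sequentially. \<forall>x\<in>UNIV. \<forall>h. norm ((\<Sum>i<n. h *\<^sub>R f' i x) - h *\<^sub>R fourier_series \<kappa> dc x) \<le> e * norm h"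
      using uniform_limitD[OF ul \<open>e > 0\<close>]
    proof (rule eventually_mono, intro ballI allI)
      fix n x and h :: real
      assume *: "\<forall>x\<in>UNIV. dist (\<Sum>i<n. f' i x) (fourier_series \<kappa> dc x) < e"
      have "norm ((\<Sum>i<n. h *\<^sub>R f' i x) - h *\<^sub>R fourier_series \<kappa> dc x) = \<bar>h\<bar> * dist (\<Sum>i<n. f' i x) (fourier_series \<kappa> dc x)"
        unfolding dist_norm by (simp add: scaleR_sum_right[symmetric] scaleR_diff_right[symmetric])
      also have "\<dots> \<le> \<bar>h\<bar> * e" using * by (intro mult_left_mono) (auto intro: less_imp_le)
      finally show "norm ((\<Sum>i<n. h *\<^sub>R f' i x) - h *\<^sub>R fourier_series \<kappa> dc x) \<le> e * norm h" by (simp add: mult.commute)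
    qed
  next
    show "(\<lambda>n. f n 0) sums fourier_series \<kappa> c 0" unfolding f_def by (rule sums[OF c])
  qed auto
  then obtain g where g: "\<And>x. (\<lambda>n. f n x) sums g x"
    "\<And>x. (g has_derivative (\<lambda>h. h *\<^sub>R fourier_series \<kappa> dc x)) (at x)" by auto
  have "g = fourier_series \<kappa> c"
    using g(1) sums[OF c] unfolding f_def by (intro ext) (metis sums_unique2)
  then show ?thesis using g(2) unfolding dc_def by (simp add: has_vector_derivative_def)
qed

lemma fourier_series_add:
  assumes "exp_decaying c" "exp_decaying d"
  shows "fourier_series \<kappa> (\<lambda>n. c n + d n) s = fourier_series \<kappa> c s + fourier_series \<kappa> d s"
  unfolding fourier_series_def distrib_right
  by (intro infsum_add fourier_term_summable assms)

lemma fourier_series_cmult: "fourier_series \<kappa> (\<lambda>n. z * c n) s = z * fourier_series \<kappa> c s"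
  unfolding fourier_series_def mult.assoc by (rule infsum_cmult_right')

lemma fourier_series_cis_mult:
  "cis (\<kappa> * of_int j * s) * fourier_series \<kappa> c s = fourier_series \<kappa> (\<lambda>n. c (n - j)) s"
proof -
  have "cis (\<kappa> * of_int j * s) * fourier_series \<kappa> c s = (\<Sum>\<^sub>\<infinity>n. cis (\<kappa> * of_int j * s) * (c n * cis (\<kappa> * of_int n * s)))"
    unfolding fourier_series_def by (rule infsum_cmult_right'[symmetric])
  also have "\<dots> = (\<Sum>\<^sub>\<infinity>n. c (n - j) * cis (\<kappa> * of_int n * s))"
    by (rule infsum_reindex_bij_witness[of _ "\<lambda>n. n - j" "\<lambda>n. n + j"])
      (auto simp: cis_mult algebra_simps)
  finally show ?thesis unfolding fourier_series_def .
qed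

lemma fourier_series_periodic:
  "fourier_series (of_int k) c (s + 2 * pi) = fourier_series (of_int k) c s"
proof -
  have "cis (of_int k * of_int n * (s + 2 * pi)) = cis (of_int k * of_int n * s)" for n
  proof -
    have "cis (of_int k * of_int n * (s + 2 * pi)) = cis (of_int k * of_int n * s) * cis (2 * pi * of_int (k * n))"
      by (simp add: cis_mult algebra_simps)
    also have "cis (2 * pi * of_int (k * n)) = 1" by (rule cis_multiple_2pi) simp
    finally show ?thesis by simp
  qed
  then show ?thesis unfolding fourier_series_def by simp
qed

lemma fourier_series_smooth:
  assumes "exp_decaying c"
  shows "circle_smooth (fourier_series (of_int k) c)"
proof -
  have "\<exists>d. exp_decaying d \<and>
     ((\<lambda>g r. vector_derivative g (at r)) ^^ n) (fourier_series (of_int k) c) = fourier_series (of_int k) d" for n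
  proof (induction n)
    case 0
    then show ?case using assms by auto
  next
    case (Suc n)
    then obtain d where d: "exp_decaying d"
      "((\<lambda>g r. vector_derivative g (at r)) ^^ n) (fourier_series (of_int k) c) = fourier_series (of_int k) d" by blast
    define e where "e = (\<lambda>n. \<i> * of_real (of_int k) * (of_int n * d n))"
    have "exp_decaying e" unfolding e_def
      by (rule exp_decaying_bounded_mult[where M = "\<bar>of_int k\<bar>"]) (auto simp: norm_mult intro: exp_decaying_linear_mult d)
    moreover have "((\<lambda>g r. vector_derivative g (at r)) ^^ Suc n) (fourier_series (of_int k) c) = fourier_series (of_int k) e"
      using d(2) vector_derivative_at[OF fourier_series_has_vector_derivative[OF d(1)]] by (auto simp: e_def)
    ultimately show ?case by blast
  qed
  then have "((\<lambda>g r. vector_derivative g (at r)) ^^ n) (fourier_series (of_int k) c) differentiable (at s)" for n s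
    using differentiableI_vector[OF fourier_series_has_vector_derivative] by metis
  then show ?thesis unfolding circle_smooth_def by (simp add: fourier_series_periodic)
qed

text \<open>Orthogonality of the exponentials: multiply by \<open>cis (- k m s)\<close> and
  integrate over a period, where convergence is uniform along the finite index sets. It ensures that
  a nonzero coefficient sequence gives a nonzero eigenfunction.\<close>

lemma fourier_series_coeff_zero:
  assumes c: "exp_decaying c" and k: "k \<noteq> 0" and zero: "\<And>s. fourier_series (of_int k) c s = 0"
  shows "c m = 0"
proof -
  define e where "e n s = cis (of_int k * of_int (n - m) * s)" for n :: int and s :: real
  have "uniform_limit (cbox 0 (2 * pi)) (\<lambda>A s. \<Sum>n\<in>A. c n * e n s) (\<lambda>s. \<Sum>\<^sub>\<infinity>n. c n * e n s) (finite_subsets_at_top UNIV)"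
    by (rule Weierstrass_m_test_general[OF _ exp_decaying_summable[OF c]]) (simp add: e_def norm_mult)
  moreover have "(\<Sum>\<^sub>\<infinity>n. c n * e n s) = 0" for s
  proof -
    have "(\<Sum>\<^sub>\<infinity>n. c n * e n s) = (\<Sum>\<^sub>\<infinity>n. cis (- (of_int k * of_int m * s)) * (c n * cis (of_int k * of_int n * s)))"
      by (intro infsum_cong) (auto simp: e_def cis_mult algebra_simps)
    also have "\<dots> = cis (- (of_int k * of_int m * s)) * fourier_series (of_int k) c s"
      unfolding fourier_series_def by (rule infsum_cmult_right')
    finally show ?thesis by (simp add: zero)
  qed
  ultimately have ul: "uniform_limit (cbox 0 (2 * pi)) (\<lambda>A s. \<Sum>n\<in>A. c n * e n s) (\<lambda>s. 0) (finite_subsets_at_top UNIV)"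
    by simp
  have int_e: "(e n has_integral (if n = m then 2 * pi else 0)) (cbox 0 (2 * pi))" for n
  proof (cases "n = m")
    case True
    then have "e n = (\<lambda>_. 1)" by (simp add: e_def fun_eq_iff)
    then show ?thesis using True has_integral_const[of "1::complex" 0 "2 * pi"] by (simp add: scaleR_conv_of_real)
  next
    case False
    define w where "w = of_int k * (of_int (n - m) :: real)"
    have w: "w \<noteq> 0" using False k by (simp add: w_def)
    have ew: "e n x = cis (w * x)" for x by (simp add: e_def w_def)
    have "(e n has_integral 1 / (\<i> * w) * cis (w * (2 * pi)) - 1 / (\<i> * w) * cis (w * 0)) {0..2 * pi}"
    proof (rule fundamental_theorem_of_calculus)
      fix x
      show "((\<lambda>x. 1 / (\<i> * w) * cis (w * x)) has_vector_derivative e n x) (at x within {0..2 * pi})"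
        using has_vector_derivative_mult_right[OF cis_has_vector_derivative[of w x], of "1 / (\<i> * of_real w)"] w
        by (simp add: ew)
    qed simp
    moreover have "cis (w * (2 * pi)) = cis (2 * pi * of_int (k * (n - m)))" by (simp add: w_def algebra_simps)
    then have "cis (w * (2 * pi)) = 1" using cis_multiple_2pi[of "of_int (k * (n - m))"] by simp
    ultimately show ?thesis using False by simp
  qed
  have cont: "continuous_on (cbox 0 (2 * pi)) (\<lambda>s. \<Sum>n\<in>A. c n * e n s)" for A
    unfolding e_def by (intro continuous_intros)
  obtain I J where IJ: "\<And>A. ((\<lambda>s. \<Sum>n\<in>A. c n * e n s) has_integral I A) (cbox 0 (2 * pi))"
    "((\<lambda>s. 0) has_integral J) (cbox 0 (2 * pi))" "(I \<longlongrightarrow> J) (finite_subsets_at_top UNIV)"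
    by (rule uniform_limit_integral_cbox[OF ul cont finite_subsets_at_top_neq_bot], rule that)
  have "J = 0" using has_integral_unique[OF IJ(2)] by simp
  have "I A = (\<Sum>n\<in>A. c n * of_real (if n = m then 2 * pi else 0))" if "finite A" for A
    by (rule has_integral_unique[OF IJ(1) has_integral_sum[OF that has_integral_mult_right[OF int_e]]])
  then have "I A = c m * of_real (2 * pi)" if "finite A" "m \<in> A" for A
    using that by (simp add: if_distrib[where f = of_real] if_distrib[where f = "\<lambda>x. _ * x"] cong: if_cong)
  then have "\<forall>\<^sub>F A in finite_subsets_at_top UNIV. I A = c m * of_real (2 * pi)"
    unfolding eventually_finite_subsets_at_top by (intro exI[of _ "{m}"]) auto
  then have "(I \<longlongrightarrow> c m * of_real (2 * pi)) (finite_subsets_at_top UNIV)" by (rule tendsto_eventually)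
  then have "c m * of_real (2 * pi) = J" using IJ(3) by (intro tendsto_unique[OF _ _ IJ(3)]) auto
  then show ?thesis using \<open>J = 0\<close> by simp
qed

subsection \<open>Smooth functions on the torus\<close>

lemma circle_smooth_vector_derivative:
  assumes "circle_smooth g"
  shows "(((\<lambda>g r. vector_derivative g (at r)) ^^ n) g has_vector_derivative
    ((\<lambda>g r. vector_derivative g (at r)) ^^ Suc n) g s) (at s)"
  using assms unfolding circle_smooth_def by (simp add: vector_derivative_works[symmetric])

lemma pd_product:
  fixes g q :: "real \<Rightarrow> 'a::real_normed_algebra"
  shows "(g has_vector_derivative g') (at (fst x)) \<Longrightarrow> pd1 (\<lambda>x. g (fst x) * q (snd x)) x = g' * q (snd x)"
    and "(q has_vector_derivative q') (at (snd x)) \<Longrightarrow> pd2 (\<lambda>x. g (fst x) * q (snd x)) x = g (fst x) * q'"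
  unfolding pd1_def pd2_def
  by (auto intro!: vector_derivative_at has_vector_derivative_mult_left has_vector_derivative_mult_right)

text \<open>Each partial derivative hits only one factor, so every word of derivatives yields a
  product of iterated one-variable derivatives, and such a product is Frechet
  differentiable.\<close>

lemma torus_smooth_product:
  fixes g q :: "real \<Rightarrow> 'a::real_normed_algebra"
  assumes "circle_smooth g" "circle_smooth q"
  shows "torus_smooth (\<lambda>x. g (fst x) * q (snd x))"
proof -
  let ?D = "\<lambda>n g. ((\<lambda>g r. vector_derivative g (at r)) ^^ n) (g :: real \<Rightarrow> 'a)"
  have "\<exists>i j. foldr (\<lambda>d. if d then pd1 else pd2) ds (\<lambda>x. g (fst x) * q (snd x)) =
      (\<lambda>x. ?D i g (fst x) * ?D j q (snd x))" for ds
  proof (induction ds)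
    case Nil
    show ?case by (rule exI[of _ 0], rule exI[of _ 0]) simp
  next
    case (Cons d ds)
    then obtain i j where IH: "foldr (\<lambda>d. if d then pd1 else pd2) ds (\<lambda>x. g (fst x) * q (snd x)) =
      (\<lambda>x. ?D i g (fst x) * ?D j q (snd x))" by blast
    have "foldr (\<lambda>d. if d then pd1 else pd2) (d # ds) (\<lambda>x. g (fst x) * q (snd x)) =
      (if d then pd1 else pd2) (\<lambda>x. ?D i g (fst x) * ?D j q (snd x))"
      unfolding foldr_Cons o_apply IH ..
    also have "\<dots> = (\<lambda>x. ?D (if d then Suc i else i) g (fst x) * ?D (if d then j else Suc j) q (snd x))"
      using pd_product[OF circle_smooth_vector_derivative[OF assms(1)]]
        pd_product(2)[OF circle_smooth_vector_derivative[OF assms(2)]]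
      by (cases d) (simp_all only: if_True if_False fun_eq_iff simp_thms)
    finally show ?case by blast
  qed
  note iter = this
  have diff: "(\<lambda>x. ?D i g (fst x) * ?D j q (snd x)) differentiable (at x)" for i j and x :: "real \<times> real"
  proof -
    have "(\<lambda>x. ?D i g (fst x)) differentiable (at x)"
      using assms(1) unfolding circle_smooth_def
      by (intro differentiable_compose[OF _ bounded_linear_imp_differentiable[OF bounded_linear_fst]]) auto
    moreover have "(\<lambda>x. ?D j q (snd x)) differentiable (at x)"
      using assms(2) unfolding circle_smooth_def
      by (intro differentiable_compose[OF _ bounded_linear_imp_differentiable[OF bounded_linear_snd]]) auto
    ultimately show ?thesis by (rule differentiable_mult)
  qed
  have "foldr (\<lambda>d. if d then pd1 else pd2) ds (\<lambda>x. g (fst x) * q (snd x)) differentiable (at x)" for ds x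
  proof -
    obtain i j where "foldr (\<lambda>d. if d then pd1 else pd2) ds (\<lambda>x. g (fst x) * q (snd x)) =
      (\<lambda>x. ?D i g (fst x) * ?D j q (snd x))" using iter by blast
    then show ?thesis using diff by simp
  qed
  then show ?thesis
    using assms unfolding torus_smooth_def by (simp add: circle_smooth_def)
qed

lemma torus_smooth_differentiable: "torus_smooth f \<Longrightarrow> f differentiable (at x)"
proof -
  assume "torus_smooth f"
  then have "foldr (\<lambda>d. if d then pd1 else pd2) [] f differentiable (at x)"
    unfolding torus_smooth_def by blast
  then show ?thesis by simp
qed

lemma torus_smooth_continuous_on: "torus_smooth f \<Longrightarrow> continuous_on S f"
  by (simp add: continuous_at_imp_continuous_on differentiable_imp_continuous_within torus_smooth_differentiable)

lemma pd_works:
  assumes "f differentiable (at x)"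
  shows "((\<lambda>s. f (s, snd x)) has_vector_derivative pd1 f x) (at (fst x))"
    and "((\<lambda>s. f (fst x, s)) has_vector_derivative pd2 f x) (at (snd x))"
proof -
  have "(\<lambda>s. f (s, snd x)) differentiable (at (fst x))"
    by (rule differentiable_compose[OF _ differentiableI[OF has_derivative_Pair[OF has_derivative_ident has_derivative_const]]])
      (simp add: assms)
  then show "((\<lambda>s. f (s, snd x)) has_vector_derivative pd1 f x) (at (fst x))"
    unfolding pd1_def by (simp add: vector_derivative_works)
  have "(\<lambda>s. f (fst x, s)) differentiable (at (snd x))"
    by (rule differentiable_compose[OF _ differentiableI[OF has_derivative_Pair[OF has_derivative_const has_derivative_ident]]])
      (simp add: assms)
  then show "((\<lambda>s. f (fst x, s)) has_vector_derivative pd2 f x) (at (snd x))"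
    unfolding pd2_def by (simp add: vector_derivative_works)
qed

lemma torus_smooth_pd:
  assumes "torus_smooth f"
  shows "torus_smooth (pd1 f)" "torus_smooth (pd2 f)"
proof -
  have per: "f (a + 2 * pi, b) = f (a, b)" "f (a, b + 2 * pi) = f (a, b)" for a b
    using assms unfolding torus_smooth_def by auto
  note works = pd_works[OF torus_smooth_differentiable[OF assms]]
  have per1: "pd1 f (a + 2 * pi, b) = pd1 f (a, b)" for a b
  proof -
    have "((\<lambda>s. f (s + 2 * pi, b)) has_vector_derivative 1 *\<^sub>R pd1 f (a + 2 * pi, b)) (at a)"
      using works(1)[of "(a + 2 * pi, b)"]
      by (intro vector_diff_chain_at[of "\<lambda>s. s + 2 * pi" 1 a "\<lambda>s. f (s, b)", unfolded o_def])
        (auto intro!: derivative_eq_intros)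
    then show ?thesis unfolding per pd1_def[of f "(a, b)"] by (simp add: vector_derivative_at)
  qed
  have per2: "pd2 f (a, b + 2 * pi) = pd2 f (a, b)" for a b
  proof -
    have "((\<lambda>s. f (a, s + 2 * pi)) has_vector_derivative 1 *\<^sub>R pd2 f (a, b + 2 * pi)) (at b)"
      using works(2)[of "(a, b + 2 * pi)"]
      by (intro vector_diff_chain_at[of "\<lambda>s. s + 2 * pi" 1 b "\<lambda>s. f (a, s)", unfolded o_def])
        (auto intro!: derivative_eq_intros)
    then show ?thesis unfolding per pd2_def[of f "(a, b)"] by (simp add: vector_derivative_at)
  qed
  \<comment> \<open>\<open>foldr\<close> applies the last letter of the word first, so the words for
    a derivative of \<open>f\<close> are those for \<open>f\<close> with one letter
    appended.\<close>
  have "foldr (\<lambda>d. if d then pd1 else pd2) (ds @ [e]) f differentiable (at x)" for ds e x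
    using assms unfolding torus_smooth_def by blast
  from this[of _ True] this[of _ False]
  have "foldr (\<lambda>d. if d then pd1 else pd2) ds (pd1 f) differentiable (at x)"
    "foldr (\<lambda>d. if d then pd1 else pd2) ds (pd2 f) differentiable (at x)" for ds x by simp_all
  then show "torus_smooth (pd1 f)" "torus_smooth (pd2 f)"
    unfolding torus_smooth_def using per1 per2 by (simp_all add: pd1_def pd2_def per)
qed

lemma torus_smooth_diff:
  assumes "torus_smooth f" "torus_smooth g"
  shows "torus_smooth (\<lambda>x. f x - g x)"
    and "pd1 (\<lambda>x. f x - g x) = (\<lambda>x. pd1 f x - pd1 g x)"
    and "pd2 (\<lambda>x. f x - g x) = (\<lambda>x. pd2 f x - pd2 g x)"
proof -
  have pd: "pd1 (\<lambda>x. f x - g x) = (\<lambda>x. pd1 f x - pd1 g x) \<and> pd2 (\<lambda>x. f x - g x) = (\<lambda>x. pd2 f x - pd2 g x)"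
    if "torus_smooth f" "torus_smooth g" for f g :: "real \<times> real \<Rightarrow> 'a"
  proof -
    have "pd1 (\<lambda>x. f x - g x) x = pd1 f x - pd1 g x" for x
      unfolding pd1_def[of "\<lambda>x. f x - g x"]
      by (intro vector_derivative_at has_vector_derivative_diff pd_works torus_smooth_differentiable that)
    moreover have "pd2 (\<lambda>x. f x - g x) x = pd2 f x - pd2 g x" for x
      unfolding pd2_def[of "\<lambda>x. f x - g x"]
      by (intro vector_derivative_at has_vector_derivative_diff pd_works torus_smooth_differentiable that)
    ultimately show ?thesis by blast
  qed
  then show "pd1 (\<lambda>x. f x - g x) = (\<lambda>x. pd1 f x - pd1 g x)"
    "pd2 (\<lambda>x. f x - g x) = (\<lambda>x. pd2 f x - pd2 g x)" using assms by blast+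
  have "\<exists>f' g'. torus_smooth f' \<and> torus_smooth g' \<and>
      foldr (\<lambda>d. if d then pd1 else pd2) ds (\<lambda>x. f x - g x) = (\<lambda>x. f' x - g' x)" for ds
  proof (induction ds)
    case Nil
    then show ?case using assms by auto
  next
    case (Cons d ds)
    then obtain f' g' where IH: "torus_smooth f'" "torus_smooth g'"
      "foldr (\<lambda>d. if d then pd1 else pd2) ds (\<lambda>x. f x - g x) = (\<lambda>x. f' x - g' x)" by blast
    have "foldr (\<lambda>d. if d then pd1 else pd2) (d # ds) (\<lambda>x. f x - g x) =
        (\<lambda>x. (if d then pd1 else pd2) f' x - (if d then pd1 else pd2) g' x)"
      using pd[OF IH(1,2)] IH(3) by (cases d) simp_all
    moreover have "torus_smooth ((if d then pd1 else pd2) f')" "torus_smooth ((if d then pd1 else pd2) g')"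
      using torus_smooth_pd IH(1,2) by auto
    ultimately show ?case by blast
  qed
  note iter = this
  have "foldr (\<lambda>d. if d then pd1 else pd2) ds (\<lambda>x. f x - g x) differentiable (at x)" for ds x
  proof -
    obtain f' g' where "torus_smooth f'" "torus_smooth g'"
      "foldr (\<lambda>d. if d then pd1 else pd2) ds (\<lambda>x. f x - g x) = (\<lambda>x. f' x - g' x)" using iter by blast
    then show ?thesis by (simp add: differentiable_diff torus_smooth_differentiable)
  qed
  then show "torus_smooth (\<lambda>x. f x - g x)"
    using assms unfolding torus_smooth_def by auto
qed

text \<open>Fubini reduces both cases to the fundamental theorem of calculus in one variable, where
  periodicity cancels the boundary terms. The derivative is an arbitrary \<open>g'\<close>, so that
  expressions from the product rule can be inserted directly.\<close>

lemma integral_pd_zero: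
  fixes g :: "real \<times> real \<Rightarrow> 'a::banach"
  assumes per: "\<And>x. g (fst x + 2 * pi, snd x) = g x" "\<And>x. g (fst x, snd x + 2 * pi) = g x"
    and cont: "continuous_on UNIV g'"
  shows "(\<And>x. ((\<lambda>s. g (s, snd x)) has_vector_derivative g' x) (at (fst x))) \<Longrightarrow>
      integral (cbox (0, 0) (2 * pi, 2 * pi)) g' = 0"
    and "(\<And>x. ((\<lambda>s. g (fst x, s)) has_vector_derivative g' x) (at (snd x))) \<Longrightarrow>
      integral (cbox (0, 0) (2 * pi, 2 * pi)) g' = 0"
proof -
  have c: "continuous_on (cbox (0, 0) (2 * pi, 2 * pi)) g'" using cont by (rule continuous_on_subset) simp
  have prod: "integral (cbox (0, 0) (2 * pi, 2 * pi)) g' =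
      integral (cbox 0 (2 * pi)) (\<lambda>x. integral (cbox 0 (2 * pi)) (\<lambda>y. g' (x, y)))"
    by (rule integral_prod_continuous[OF c])
  have swap: "integral (cbox 0 (2 * pi)) (\<lambda>x. integral (cbox 0 (2 * pi)) (\<lambda>y. g' (x, y))) =
      integral (cbox 0 (2 * pi)) (\<lambda>y. integral (cbox 0 (2 * pi)) (\<lambda>x. g' (x, y)))"
    by (rule integral_swap_continuous) (use c in simp)
  {
    assume der: "\<And>x. ((\<lambda>s. g (s, snd x)) has_vector_derivative g' x) (at (fst x))"
    have "integral (cbox 0 (2 * pi)) (\<lambda>x. g' (x, y)) = 0" for y
    proof -
      have "((\<lambda>x. g' (x, y)) has_integral g (2 * pi, y) - g (0, y)) {0..2 * pi}"
        using der[of "(_, y)"] by (intro fundamental_theorem_of_calculus) (auto intro: has_vector_derivative_at_within)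
      then show ?thesis using per(1)[of "(0, y)"] by (simp add: integral_unique)
    qed
    then show "integral (cbox (0, 0) (2 * pi, 2 * pi)) g' = 0" unfolding prod swap by simp
  }
  {
    assume der: "\<And>x. ((\<lambda>s. g (fst x, s)) has_vector_derivative g' x) (at (snd x))"
    have "integral (cbox 0 (2 * pi)) (\<lambda>y. g' (x, y)) = 0" for x
    proof -
      have "((\<lambda>y. g' (x, y)) has_integral g (x, 2 * pi) - g (x, 0)) {0..2 * pi}"
        using der[of "(x, _)"] by (intro fundamental_theorem_of_calculus) (auto intro: has_vector_derivative_at_within)
      then show ?thesis using per(2)[of "(x, 0)"] by (simp add: integral_unique)
    qed
    then show "integral (cbox (0, 0) (2 * pi, 2 * pi)) g' = 0" unfolding prod by simp
  }
qed

section \<open>Uniqueness for the Laplace and Helmholtz equations on the torus\<close>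

lemma torus_smooth_periodic:
  assumes "torus_smooth f"
  shows "f (fst x + 2 * pi, snd x) = f x" "f (fst x, snd x + 2 * pi) = f x"
  using assms unfolding torus_smooth_def by auto

text \<open>Integrating \<open>p \<bullet> (c p - \<Delta> p) = 0\<close> by parts gives \<open>\<integral> c |p|^2 + |\<nabla> p|^2 = 0\<close>.\<close>

lemma torus_energy_zero:
  fixes p :: "real \<times> real \<Rightarrow> complex"
  assumes p: "torus_smooth p" and c: "c \<ge> 0" and eq: "\<And>x. c *\<^sub>R p x = laplace p x"
  shows "\<And>x. pd1 p x = 0" "\<And>x. pd2 p x = 0" "\<And>x. c *\<^sub>R p x = 0"
proof -
  let ?B = "cbox (0, 0) (2 * pi, 2 * pi) :: (real \<times> real) set"
  note sm = p torus_smooth_pd[OF p] torus_smooth_pd[OF torus_smooth_pd(1)[OF p]] torus_smooth_pd[OF torus_smooth_pd(2)[OF p]]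
  note cont = sm[THEN torus_smooth_continuous_on]
  \<comment> \<open>\<open>g1\<close> and \<open>g2\<close> are the \<open>x1\<close>- and
    \<open>x2\<close>-derivatives of \<open>p \<bullet> pd1 p\<close> and
    \<open>p \<bullet> pd2 p\<close>; their sum is the nonnegative energy density
    \<open>e\<close>.\<close>
  define g1 where "g1 x = p x \<bullet> pd1 (pd1 p) x + pd1 p x \<bullet> pd1 p x" for x
  define g2 where "g2 x = p x \<bullet> pd2 (pd2 p) x + pd2 p x \<bullet> pd2 p x" for x
  have i1: "integral ?B g1 = 0"
  proof (rule integral_pd_zero(1)[of "\<lambda>x. p x \<bullet> pd1 p x"])
    show "continuous_on UNIV g1" unfolding g1_def by (intro continuous_intros cont)
    show "((\<lambda>s. p (s, snd x) \<bullet> pd1 p (s, snd x)) has_vector_derivative g1 x) (at (fst x))" for x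
      using bounded_bilinear.has_vector_derivative[OF bounded_bilinear_inner
        pd_works(1)[OF torus_smooth_differentiable[OF sm(1)], of x] pd_works(1)[OF torus_smooth_differentiable[OF sm(2)], of x]]
      by (simp add: g1_def)
  qed (simp_all add: torus_smooth_periodic[OF sm(1)] torus_smooth_periodic[OF sm(2)])
  have i2: "integral ?B g2 = 0"
  proof (rule integral_pd_zero(2)[of "\<lambda>x. p x \<bullet> pd2 p x"])
    show "continuous_on UNIV g2" unfolding g2_def by (intro continuous_intros cont)
    show "((\<lambda>s. p (fst x, s) \<bullet> pd2 p (fst x, s)) has_vector_derivative g2 x) (at (snd x))" for x
      using bounded_bilinear.has_vector_derivative[OF bounded_bilinear_inner
        pd_works(2)[OF torus_smooth_differentiable[OF sm(1)], of x] pd_works(2)[OF torus_smooth_differentiable[OF sm(3)], of x]]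
      by (simp add: g2_def)
  qed (simp_all add: torus_smooth_periodic[OF sm(1)] torus_smooth_periodic[OF sm(3)])
  define e where "e x = c * (p x \<bullet> p x) + pd1 p x \<bullet> pd1 p x + pd2 p x \<bullet> pd2 p x" for x
  have "e x = g1 x + g2 x" for x
  proof -
    have "p x \<bullet> (c *\<^sub>R p x) = p x \<bullet> pd1 (pd1 p) x + p x \<bullet> pd2 (pd2 p) x"
      unfolding eq laplace_def by (rule inner_add_right)
    then show ?thesis unfolding e_def g1_def g2_def by simp
  qed
  moreover have "g1 integrable_on ?B" "g2 integrable_on ?B"
    unfolding g1_def g2_def by (intro integrable_continuous continuous_intros cont)+
  ultimately have int0: "integral ?B e = 0"
    using i1 i2 integral_add[of g1 ?B g2] by (simp cong: integral_cong)
  have econt: "continuous_on ?B e" unfolding e_def by (intro continuous_intros cont)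
  have e0: "\<forall>x\<in>?B. e x = 0"
  proof (subst integral_cbox_eq_0_iff[symmetric])
    show "box (0, 0) (2 * pi, 2 * pi) \<noteq> ({} :: (real \<times> real) set)"
      by (auto simp: box_ne_empty Basis_prod_def)
  qed (use int0 econt c in \<open>auto simp: e_def\<close>)
  have key: "c *\<^sub>R p x = 0 \<and> pd1 p x = 0 \<and> pd2 p x = 0" if "x \<in> ?B" for x
  proof -
    have "e x = 0" using e0 that by blast
    moreover have "c * (p x \<bullet> p x) \<ge> 0" "pd1 p x \<bullet> pd1 p x \<ge> 0" "pd2 p x \<bullet> pd2 p x \<ge> 0"
      using c by auto
    ultimately have "c * (p x \<bullet> p x) = 0" "pd1 p x \<bullet> pd1 p x = 0" "pd2 p x \<bullet> pd2 p x = 0"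
      unfolding e_def by linarith+
    then show ?thesis by auto
  qed
  \<comment> \<open>So far everything vanishes on one period cell only. The representative
    \<open>y\<close> is chosen independently of \<open>f\<close>, so it serves \<open>p\<close> and
    both its derivatives.\<close>
  have move: "\<exists>y\<in>?B. \<forall>f::real \<times> real \<Rightarrow> complex. torus_smooth f \<longrightarrow> f x = f y" for x
  proof -
    have per1: "f (a + 2 * pi * of_int n, b) = f (a, b)" if "torus_smooth f" for f :: "real \<times> real \<Rightarrow> complex" and a b n
    proof (induction n rule: int_induct[where k = 0])
      case (step1 i)
      then show ?case using torus_smooth_periodic(1)[OF that, of "(a + 2 * pi * of_int i, b)"] by (simp add: algebra_simps)
    next
      case (step2 i)
      then show ?case using torus_smooth_periodic(1)[OF that, of "(a + 2 * pi * of_int (i - 1), b)"] by (simp add: algebra_simps)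
    qed simp
    have per2: "f (a, b + 2 * pi * of_int n) = f (a, b)" if "torus_smooth f" for f :: "real \<times> real \<Rightarrow> complex" and a b n
    proof (induction n rule: int_induct[where k = 0])
      case (step1 i)
      then show ?case using torus_smooth_periodic(2)[OF that, of "(a, b + 2 * pi * of_int i)"] by (simp add: algebra_simps)
    next
      case (step2 i)
      then show ?case using torus_smooth_periodic(2)[OF that, of "(a, b + 2 * pi * of_int (i - 1))"] by (simp add: algebra_simps)
    qed simp
    define r where "r a = 2 * pi * frac (a / (2 * pi))" for a :: real
    have r: "0 \<le> r a" "r a \<le> 2 * pi" for a
      using frac_ge_0[of "a / (2 * pi)"] frac_lt_1[of "a / (2 * pi)"] by (simp_all add: r_def mult_left_le)
    have r_floor: "r a + 2 * pi * of_int \<lfloor>a / (2 * pi)\<rfloor> = a" for a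
      by (simp add: r_def frac_def right_diff_distrib)
    have "f x = f (r (fst x), r (snd x))" if "torus_smooth f" for f :: "real \<times> real \<Rightarrow> complex"
      using per1[OF that, of "r (fst x)" "\<lfloor>fst x / (2 * pi)\<rfloor>" "snd x"]
        per2[OF that, of "r (fst x)" "r (snd x)" "\<lfloor>snd x / (2 * pi)\<rfloor>"]
      unfolding r_floor by simp
    moreover have "(r (fst x), r (snd x)) \<in> ?B" using r by (simp add: cbox_Pair_eq)
    ultimately show ?thesis by blast
  qed
  fix x
  obtain y where y: "y \<in> ?B" "\<And>f::real \<times> real \<Rightarrow> complex. torus_smooth f \<Longrightarrow> f x = f y" using move[of x] by blast
  show "pd1 p x = 0" "pd2 p x = 0" "c *\<^sub>R p x = 0"
    using key[OF y(1)] y(2)[OF sm(1)] y(2)[OF sm(2)] y(2)[OF sm(3)] by simp_all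
qed

text \<open>Evaluates the definite description from a single exhibited solution: the difference
  \<open>d\<close> of two solutions satisfies \<open>d = laplace d\<close>, and the energy identity
  with \<open>c = 1\<close> makes it vanish.\<close>

lemma inv_helmholtz_eq:
  assumes p: "torus_smooth p" "\<And>x. p x - laplace p x = g x"
  shows "inv_helmholtz g = p"
  unfolding inv_helmholtz_def
proof (rule the_equality)
  fix p' assume p': "torus_smooth p' \<and> (\<lambda>x. p' x - laplace p' x) = g"
  define d where "d = (\<lambda>x. p' x - p x)"
  note D = torus_smooth_diff[OF conjunct1[OF p'] p(1)]
  have "laplace d x = laplace p' x - laplace p x" for x
    unfolding d_def laplace_def D(2,3)
    using torus_smooth_diff(2)[OF torus_smooth_pd(1)[OF conjunct1[OF p']] torus_smooth_pd(1)[OF p(1)]]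
      torus_smooth_diff(3)[OF torus_smooth_pd(2)[OF conjunct1[OF p']] torus_smooth_pd(2)[OF p(1)]] by simp
  moreover have "p' x - p x = laplace p' x - laplace p x" for x
  proof -
    have "p' x - p x = (p' x - laplace p' x) - (p x - laplace p x) + (laplace p' x - laplace p x)" by simp
    also have "(p' x - laplace p' x) - (p x - laplace p x) = 0"
      unfolding p(2) using fun_cong[OF conjunct2[OF p'], of x] by simp
    finally show ?thesis by simp
  qed
  ultimately have eq: "1 *\<^sub>R d x = laplace d x" for x by (simp add: d_def)
  have "torus_smooth d" using D(1) unfolding d_def .
  then have "d x = 0" for x using torus_energy_zero(3)[OF _ zero_le_one eq, of x] by simp
  then show "p' = p" unfolding d_def by auto
qed (simp_all add: p fun_eq_iff)

text \<open>Here the energy identity with \<open>c = 0\<close> kills only the gradient of the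
  difference, which is therefore constant; the mean-zero condition fixes the constant.\<close>

lemma inv_laplace_eq:
  assumes p: "torus_smooth p" "mean_zero p" "\<And>x. laplace p x = w x"
  shows "inv_laplace w = p"
  unfolding inv_laplace_def
proof (rule the_equality)
  fix p' assume p': "torus_smooth p' \<and> mean_zero p' \<and> laplace p' = w"
  define d where "d = (\<lambda>x. p' x - p x)"
  note D = torus_smooth_diff[OF conjunct1[OF p'] p(1)]
  have ld: "laplace d x = laplace p' x - laplace p x" for x
    unfolding d_def laplace_def D(2,3)
    using torus_smooth_diff(2)[OF torus_smooth_pd(1)[OF conjunct1[OF p']] torus_smooth_pd(1)[OF p(1)]]
      torus_smooth_diff(3)[OF torus_smooth_pd(2)[OF conjunct1[OF p']] torus_smooth_pd(2)[OF p(1)]] by simp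
  have dsm: "torus_smooth d" using D(1) unfolding d_def .
  have z: "0 *\<^sub>R d x = laplace d x" for x
    unfolding ld p(3) using fun_cong[OF conjunct2[OF conjunct2[OF p']], of x] by simp
  note grad = torus_energy_zero(1,2)[OF dsm order_refl z]
  have const: "d x = d (0, 0)" for x
  proof -
    have "d (fst x, snd x) = d (0, snd x)"
    proof (rule has_derivative_zero_unique[OF convex_UNIV, of "\<lambda>s. d (s, snd x)"])
      show "((\<lambda>s. d (s, snd x)) has_derivative (\<lambda>h. 0)) (at s)" for s
        using pd_works(1)[OF torus_smooth_differentiable[OF dsm], of "(s, snd x)"] grad(1)
        by (simp add: has_vector_derivative_def)
    qed auto
    also have "\<dots> = d (0, 0)"
    proof (rule has_derivative_zero_unique[OF convex_UNIV, of "\<lambda>s. d (0, s)"])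
      show "((\<lambda>s. d (0, s)) has_derivative (\<lambda>h. 0)) (at s)" for s
        using pd_works(2)[OF torus_smooth_differentiable[OF dsm], of "(0, s)"] grad(2)
        by (simp add: has_vector_derivative_def)
    qed auto
    finally show ?thesis by simp
  qed
  let ?B = "cbox (0, 0) (2 * pi, 2 * pi) :: (real \<times> real) set"
  have "integral ?B d = integral ?B p' - integral ?B p"
    unfolding d_def
    by (rule integral_diff; rule integrable_continuous, rule torus_smooth_continuous_on)
      (use p' p(1) in blast)+
  also have "\<dots> = 0" using p' p(2) unfolding mean_zero_def by simp
  finally have "integral ?B d = 0" .
  moreover have "integral ?B d = integral ?B (\<lambda>_. d (0, 0))" by (rule integral_cong) (rule const)
  ultimately have "measure lborel ?B *\<^sub>R d (0, 0) = 0" by simp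
  moreover have "measure lborel ?B \<noteq> 0" by (simp add: content_Pair)
  ultimately have "d x = 0" for x using const[of x] by simp
  then show "p' = p" unfolding d_def by auto
qed (simp_all add: p fun_eq_iff)

subsection \<open>The eigenfunction\<close>

text \<open>Sine and cosine are treated together because their span is closed under differentiation,
  which makes the induction on the order go through.\<close>

lemma circle_smooth_trig:
  "circle_smooth (\<lambda>s::real. c * sin (of_int k * s) + d * cos (of_int k * s))"
proof -
  let ?f = "\<lambda>c d s::real. c * sin (of_int k * s) + d * cos (of_int k * s)"
  have der: "(?f c d has_vector_derivative ?f (- (d * of_int k)) (c * of_int k) s) (at s)" for c d s
    unfolding has_real_derivative_iff_has_vector_derivative[symmetric]
    by (auto intro!: derivative_eq_intros)
  have "\<exists>c' d'. ((\<lambda>g r. vector_derivative g (at r)) ^^ n) (?f c d) = ?f c' d'" for n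
  proof (induction n)
    case (Suc n)
    then obtain c' d' where "((\<lambda>g r. vector_derivative g (at r)) ^^ n) (?f c d) = ?f c' d'" by blast
    then have "((\<lambda>g r. vector_derivative g (at r)) ^^ Suc n) (?f c d) = ?f (- (d' * of_int k)) (c' * of_int k)"
      using vector_derivative_at[OF der] by simp
    then show ?case by blast
  qed auto
  then have "((\<lambda>g r. vector_derivative g (at r)) ^^ n) (?f c d) differentiable (at s)" for n s
    using differentiableI_vector[OF der] by metis
  moreover have "?f c d (s + 2 * pi) = ?f c d s" for s
    using sin_int_2pin[of k] cos_int_2pin[of k]
    by (simp add: distrib_left sin_add cos_add mult.commute mult.left_commute)
  ultimately show ?thesis unfolding circle_smooth_def by blast
qed

lemma circle_smooth_const: "circle_smooth (\<lambda>_. c)"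
proof -
  have "\<exists>c'. ((\<lambda>g r. vector_derivative g (at r)) ^^ n) (\<lambda>_::real. c) = (\<lambda>_. c')" for n
    by (induction n) auto
  then have "((\<lambda>g r. vector_derivative g (at r)) ^^ n) (\<lambda>_::real. c) differentiable (at s)" for n s
    by (metis differentiable_const)
  then show ?thesis unfolding circle_smooth_def by simp
qed

lemma circle_smooth_cis: "circle_smooth cis"
proof -
  have der: "((\<lambda>s. c * cis s) has_vector_derivative (c * \<i>) * cis s) (at s)" for c s
    using has_vector_derivative_mult_right[OF cis_has_vector_derivative[of 1 s], of c] by (simp add: mult.assoc)
  have "\<exists>c. ((\<lambda>g r. vector_derivative g (at r)) ^^ n) cis = (\<lambda>s. c * cis s)" for n
  proof (induction n)
    case 0
    show ?case by (rule exI[of _ 1]) simp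
  next
    case (Suc n)
    then obtain c where "((\<lambda>g r. vector_derivative g (at r)) ^^ n) cis = (\<lambda>s. c * cis s)" by blast
    then have "((\<lambda>g r. vector_derivative g (at r)) ^^ Suc n) cis = (\<lambda>s. (c * \<i>) * cis s)"
      using vector_derivative_at[OF der] by simp
    then show ?case by blast
  qed
  then have "((\<lambda>g r. vector_derivative g (at r)) ^^ n) cis differentiable (at s)" for n s
    using differentiableI_vector[OF der] by metis
  moreover have "cis (s + 2 * pi) = cis s" for s by (simp add: complex_eq_iff)
  ultimately show ?thesis unfolding circle_smooth_def by blast
qed

section \<open>The shear flow as a steady state\<close>

lemma torus_smooth_sin: "torus_smooth (\<lambda>x. c * sin (of_int k * fst x) :: real)"
  using torus_smooth_product[OF circle_smooth_trig[of c k 0] circle_smooth_const[of 1]] by simp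

lemma pd_sin:
  "pd1 (\<lambda>x. c * sin (of_int k * fst x) :: real) x = c * of_int k * cos (of_int k * fst x)"
  "pd1 (\<lambda>x. c * cos (of_int k * fst x) :: real) x = - c * of_int k * sin (of_int k * fst x)"
  "pd2 (\<lambda>x. h (fst x)) x = (0::'a::real_normed_vector)"
proof -
  have "((\<lambda>s. c * sin (of_int k * s)) has_real_derivative c * of_int k * cos (of_int k * fst x)) (at (fst x))"
    "((\<lambda>s. c * cos (of_int k * s)) has_real_derivative - c * of_int k * sin (of_int k * fst x)) (at (fst x))"
    by (auto intro!: derivative_eq_intros)
  then show "pd1 (\<lambda>x. c * sin (of_int k * fst x) :: real) x = c * of_int k * cos (of_int k * fst x)"
    "pd1 (\<lambda>x. c * cos (of_int k * fst x) :: real) x = - c * of_int k * sin (of_int k * fst x)"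
    unfolding pd1_def has_real_derivative_iff_has_vector_derivative by (simp_all add: vector_derivative_at)
qed (simp add: pd2_def)

lemma laplace_sin:
  "laplace (\<lambda>x. c * sin (of_int k * fst x) :: real) = (\<lambda>x. - (c * (of_int k)\<^sup>2) * sin (of_int k * fst x))"
proof -
  have 1: "pd1 (\<lambda>x. c * sin (of_int k * fst x) :: real) = (\<lambda>x. (c * of_int k) * cos (of_int k * fst x))"
    using pd_sin(1) by (simp add: fun_eq_iff)
  have 2: "pd2 (\<lambda>x. c * sin (of_int k * fst x) :: real) = (\<lambda>x. 0)"
    using pd_sin(3)[of "\<lambda>s. c * sin (of_int k * s)"] by (simp add: fun_eq_iff)
  have 3: "pd2 (\<lambda>x. 0 :: real) x = 0" for x by (rule pd_sin(3))
  show ?thesis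
    unfolding laplace_def 1 2 pd_sin(2) 3 by (simp add: power2_eq_square mult.assoc)
qed

text \<open>All fields depend on \<open>x1\<close> alone and the velocities point along
  \<open>x2\<close>, so every advection term vanishes separately.\<close>

lemma shear_steady_state: "imhd_steady_state (psi_star k) (Phi_star a k)"
proof -
  have psi: "psi_star k = (\<lambda>x. 1 * sin (of_int k * fst x))" by (simp add: psi_star_def fun_eq_iff)
  have Phi: "Phi_star a k = (\<lambda>x. a * sin (of_int k * fst x))" by (simp add: Phi_star_def fun_eq_iff)
  have F: "(\<lambda>x. Phi_star a k x - laplace (Phi_star a k) x) =
      (\<lambda>x. (a + a * (of_int k)\<^sup>2) * sin (of_int k * fst x))"
    unfolding Phi laplace_sin by (simp add: fun_eq_iff algebra_simps)
  have adv: "advect (perp_grad (\<lambda>x. c * sin (of_int k * fst x))) (\<lambda>x. d * sin (of_int k * fst x)) x = (0::real)" for c d x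
    unfolding advect_def perp_grad_def using pd_sin(3)[of "\<lambda>s. c * sin (of_int k * s)"]
      pd_sin(3)[of "\<lambda>s. d * sin (of_int k * s)"] by simp
  show ?thesis
    unfolding imhd_steady_state_def imhd_solution_def F
    unfolding psi laplace_sin Phi adv
    using F torus_smooth_sin[of "- (of_int k)\<^sup>2" k] torus_smooth_sin[of 1 k]
    unfolding Phi laplace_sin by (simp add: torus_smooth_sin fun_eq_iff)
qed

text \<open>The factor \<open>c\<close> is kept apart from the coefficients: it carries the growth
  in time and absorbs the \<open>\<i>\<close> produced by \<open>pd2\<close>, while
  \<open>pd1\<close> acts on \<open>d\<close> only.\<close>

definition transverse_mode :: "int \<Rightarrow> complex \<Rightarrow> (int \<Rightarrow> complex) \<Rightarrow> real \<times> real \<Rightarrow> complex" where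
  "transverse_mode k c d x = c * exp (\<i> * of_real (snd x)) * fourier_series (of_int k) d (fst x)"

lemma transverse_mode_add:
  assumes "exp_decaying d" "exp_decaying e"
  shows "transverse_mode k c (\<lambda>n. d n + e n) x = transverse_mode k c d x + transverse_mode k c e x"
  unfolding transverse_mode_def fourier_series_add[OF assms] by (simp add: algebra_simps)

lemma transverse_mode_cmult: "transverse_mode k c (\<lambda>n. z * d n) x = z * transverse_mode k c d x"
  unfolding transverse_mode_def fourier_series_cmult by (simp add: algebra_simps)

lemma exp_decaying_cmult: "exp_decaying d \<Longrightarrow> exp_decaying (\<lambda>n. z * d n)"
  by (rule exp_decaying_bounded_mult[where M = "norm z"]) auto

lemma exp_decaying_deriv: "exp_decaying d \<Longrightarrow> exp_decaying (\<lambda>n. z * (of_int n * d n))"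
  by (intro exp_decaying_cmult exp_decaying_linear_mult)

context
  fixes k :: int and c :: complex and d :: "int \<Rightarrow> complex"
  assumes d: "exp_decaying d"
begin

lemma transverse_mode_product:
  "transverse_mode k c d = (\<lambda>x. fourier_series (of_int k) (\<lambda>n. c * d n) (fst x) * cis (snd x))"
  by (simp add: transverse_mode_def fourier_series_cmult cis_conv_exp fun_eq_iff mult_ac)

lemma transverse_mode_smooth: "torus_smooth (transverse_mode k c d)"
  unfolding transverse_mode_product
  by (intro torus_smooth_product circle_smooth_cis fourier_series_smooth exp_decaying_cmult d)

lemma transverse_mode_pd:
  "pd1 (transverse_mode k c d) = transverse_mode k c (\<lambda>n. \<i> * of_real (of_int k) * (of_int n * d n))"
  "pd2 (transverse_mode k c d) = transverse_mode k (\<i> * c) d"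
proof -
  have "pd1 (transverse_mode k c d) x = transverse_mode k c (\<lambda>n. \<i> * of_real (of_int k) * (of_int n * d n)) x" for x
    unfolding transverse_mode_product
    by (subst pd_product(1)[OF fourier_series_has_vector_derivative])
      (auto simp: exp_decaying_cmult d transverse_mode_def fourier_series_cmult[symmetric] cis_conv_exp mult_ac)
  moreover have der: "(cis has_vector_derivative \<i> * cis s) (at s)" for s
    using cis_has_vector_derivative[of 1 s] by simp
  have "pd2 (transverse_mode k c d) x = transverse_mode k (\<i> * c) d x" for x
    unfolding transverse_mode_product pd_product(2)[OF der]
    by (simp add: transverse_mode_def fourier_series_cmult cis_conv_exp mult_ac)
  ultimately show "pd1 (transverse_mode k c d) = transverse_mode k c (\<lambda>n. \<i> * of_real (of_int k) * (of_int n * d n))"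
    "pd2 (transverse_mode k c d) = transverse_mode k (\<i> * c) d" by blast+
qed

end

lemma transverse_mode_laplace:
  assumes d: "exp_decaying d"
  shows "laplace (transverse_mode k c d) x = transverse_mode k c (\<lambda>n. - (1 + (of_int k * of_int n)\<^sup>2) * d n) x"
proof -
  note d1 = exp_decaying_deriv[OF d, of "\<i> * of_real (of_int k)"]
  note d2 = exp_decaying_deriv[OF d1, of "\<i> * of_real (of_int k)"]
  have "laplace (transverse_mode k c d) x =
      transverse_mode k c (\<lambda>n. \<i> * of_real (of_int k) * (of_int n * (\<i> * of_real (of_int k) * (of_int n * d n)))) x
      + transverse_mode k (\<i> * (\<i> * c)) d x"
    unfolding laplace_def transverse_mode_pd[OF d] transverse_mode_pd(1)[OF d1] transverse_mode_pd(2)[OF d] ..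
  also have "transverse_mode k (\<i> * (\<i> * c)) d x = transverse_mode k c (\<lambda>n. - 1 * d n) x"
    unfolding transverse_mode_cmult by (simp add: transverse_mode_def flip: mult.assoc)
  also have "transverse_mode k c (\<lambda>n. \<i> * of_real (of_int k) * (of_int n * (\<i> * of_real (of_int k) * (of_int n * d n)))) x
      + transverse_mode k c (\<lambda>n. - 1 * d n) x =
    transverse_mode k c (\<lambda>n. \<i> * of_real (of_int k) * (of_int n * (\<i> * of_real (of_int k) * (of_int n * d n))) + - 1 * d n) x"
    by (rule transverse_mode_add[symmetric, OF d2 exp_decaying_cmult[OF d]])
  also have "(\<lambda>n. \<i> * of_real (of_int k) * (of_int n * (\<i> * of_real (of_int k) * (of_int n * d n))) + - 1 * d n) =
      (\<lambda>n. - (1 + (of_int k * of_int n)\<^sup>2) * d n)"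
    by (rule ext) (simp add: power2_eq_square algebra_simps)
  finally show ?thesis .
qed

text \<open>The mode is itself an \<open>x2\<close>-derivative of a periodic function, namely of the
  mode with prefactor \<open>- \<i> * c\<close>.\<close>

lemma transverse_mode_mean_zero:
  assumes d: "exp_decaying d"
  shows "mean_zero (transverse_mode k c d)"
  unfolding mean_zero_def
proof (rule integral_pd_zero(2)[of "transverse_mode k (- \<i> * c) d"])
  note sm = transverse_mode_smooth[OF d, of k]
  show "((\<lambda>s. transverse_mode k (- \<i> * c) d (fst x, s)) has_vector_derivative transverse_mode k c d x) (at (snd x))" for x
    using pd_works(2)[OF torus_smooth_differentiable[OF sm], of "- \<i> * c" x]
    unfolding transverse_mode_pd(2)[OF d] by simp
qed (simp_all only: torus_smooth_periodic[OF transverse_mode_smooth[OF d]]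
      torus_smooth_continuous_on[OF transverse_mode_smooth[OF d]])

lemma cos_times_fourier_series:
  assumes "exp_decaying d"
  shows "of_real (cos (\<kappa> * s)) * fourier_series \<kappa> d s = fourier_series \<kappa> (\<lambda>n. 1 / 2 * (d (n - 1) + d (n + 1))) s"
proof -
  have "of_real (cos (\<kappa> * s)) = 1 / 2 * (cis (\<kappa> * of_int 1 * s) + cis (\<kappa> * of_int (- 1) * s))"
    by (simp add: complex_eq_iff)
  then have "of_real (cos (\<kappa> * s)) * fourier_series \<kappa> d s =
      1 / 2 * (cis (\<kappa> * of_int 1 * s) * fourier_series \<kappa> d s + cis (\<kappa> * of_int (- 1) * s) * fourier_series \<kappa> d s)"
    by (simp only: distrib_left distrib_right mult.assoc)
  also have "\<dots> = 1 / 2 * (fourier_series \<kappa> (\<lambda>n. d (n - 1)) s + fourier_series \<kappa> (\<lambda>n. d (n + 1)) s)"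
    unfolding fourier_series_cis_mult by simp
  also have "\<dots> = fourier_series \<kappa> (\<lambda>n. 1 / 2 * (d (n - 1) + d (n + 1))) s"
    unfolding fourier_series_cmult
    using fourier_series_add[OF exp_decaying_shift[OF assms, of "-1"] exp_decaying_shift[OF assms, of 1], of \<kappa> s] by simp
  finally show ?thesis .
qed

definition twist :: "(int \<Rightarrow> real) \<Rightarrow> int \<Rightarrow> complex" where
  "twist A n = \<i> powi n * of_real (A n)"

lemma twist_decaying:
  assumes "0 < \<sigma>" "\<sigma> < 1" "\<And>n. \<bar>A n\<bar> \<le> B * \<sigma> ^ nat \<bar>n\<bar>"
  shows "exp_decaying (twist A)"
  using assms unfolding exp_decaying_def twist_def by (auto simp: norm_mult norm_power_int)

text \<open>Since \<open>\<i> * \<i> powi (n - 1)\<close> and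
  \<open>\<i> * \<i> powi (n + 1)\<close> are opposite, the symmetric average of neighbours coming
  from the cosine becomes a real skew difference.\<close>

lemma twist_shift:
  "\<i> * of_real K * (1 / 2 * (twist A (n - 1) + twist A (n + 1))) = twist (\<lambda>n. - (K / 2 * (A (n + 1) - A (n - 1)))) n"
proof -
  have 1: "\<i> * \<i> powi (n - 1) = \<i> powi n" using power_int_add_1'[of \<i> "n - 1"] by simp
  have 2: "\<i> * \<i> powi (n + 1) = - (\<i> powi n)" using power_int_add_1'[of \<i> n] by (simp flip: mult.assoc)
  have "\<i> * of_real K * (1 / 2 * (twist A (n - 1) + twist A (n + 1))) =
      of_real K / 2 * ((\<i> * \<i> powi (n - 1)) * of_real (A (n - 1)) + (\<i> * \<i> powi (n + 1)) * of_real (A (n + 1)))"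
    by (simp add: twist_def algebra_simps)
  also have "\<dots> = twist (\<lambda>n. - (K / 2 * (A (n + 1) - A (n - 1)))) n"
    unfolding 1 2 by (simp add: twist_def algebra_simps)
  finally show ?thesis .
qed

text \<open>Carries the real recurrence back to the equation: by \<open>shear_advect\<close> the
  right-hand side is minus the advection of the mode with coefficients
  \<open>twist Z\<close>.\<close>

lemma twist_recurrence:
  assumes dec: "exp_decaying (twist Z)"
    and rec: "\<And>n. l * A n = of_int k / 2 * (Z (n + 1) - Z (n - 1))"
  shows "of_real l * transverse_mode k c (twist A) x =
    - (of_real (of_int k * cos (of_int k * fst x)) * transverse_mode k (\<i> * c) (twist Z) x)"
proof -
  have "\<i> * of_real (of_int k) * (of_real (cos (of_int k * fst x)) * fourier_series (of_int k) (twist Z) (fst x)) =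
      fourier_series (of_int k) (\<lambda>n. \<i> * of_real (of_int k) * (1 / 2 * (twist Z (n - 1) + twist Z (n + 1)))) (fst x)"
    unfolding cos_times_fourier_series[OF dec] fourier_series_cmult ..
  also have "(\<lambda>n. \<i> * of_real (of_int k) * (1 / 2 * (twist Z (n - 1) + twist Z (n + 1)))) =
      (\<lambda>n. - of_real l * twist A n)"
    unfolding twist_shift rec[symmetric] by (simp add: twist_def fun_eq_iff)
  finally have "\<i> * of_real (of_int k) * (of_real (cos (of_int k * fst x)) * fourier_series (of_int k) (twist Z) (fst x)) =
      - of_real l * fourier_series (of_int k) (twist A) (fst x)"
    unfolding fourier_series_cmult .
  from arg_cong[OF this, of "\<lambda>z. - (c * exp (\<i> * of_real (snd x))) * z"]
  show ?thesis unfolding transverse_mode_def by (simp add: mult_ac)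
qed

lemma shear_advect:
  assumes "exp_decaying d"
  shows "advect (perp_grad (psi_star k)) (transverse_mode k c d) x =
    of_real (of_int k * cos (of_int k * fst x)) * transverse_mode k (\<i> * c) d x"
proof -
  have psi: "psi_star k = (\<lambda>x. 1 * sin (of_int k * fst x))" by (simp add: psi_star_def fun_eq_iff)
  have "perp_grad (psi_star k) x = (0, of_int k * cos (of_int k * fst x))"
    unfolding perp_grad_def psi pd_sin(1) using pd_sin(3)[of "\<lambda>s. 1 * sin (of_int k * s)" x] by simp
  then show ?thesis unfolding advect_def transverse_mode_pd(2)[OF assms] by (simp add: scaleR_conv_of_real)
qed

section \<open>Inverse operators on modes and the growing solution\<close>

context imhd
begin

lemma inv_laplace_mode:
  assumes "exp_decaying (twist A)"
  shows "inv_laplace (transverse_mode k c (twist A)) = transverse_mode k c (\<lambda>n. of_real (- q n) * twist A n)"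
proof -
  have dec: "exp_decaying (\<lambda>n. of_real (- q n) * twist A n)"
    by (rule exp_decaying_bounded_mult[OF assms, where M = 1]) (use q_pos q_le1 in \<open>simp add: less_imp_le\<close>)
  have eq: "- (1 + (of_int k * of_int n)\<^sup>2) * (of_real (- q n) * twist A n) = twist A n" for n
  proof -
    have "(1 + (K * of_int n)\<^sup>2) * q n = 1" using q_pos[of n] unfolding q_def by (simp add: field_simps)
    then have "complex_of_real ((1 + (K * of_int n)\<^sup>2) * q n) = 1" by simp
    then have "(1 + (of_int k * of_int n)\<^sup>2) * complex_of_real (q n) = 1" by (simp add: K_def)
    then have "((1 + (of_int k * of_int n)\<^sup>2) * complex_of_real (q n)) * twist A n = twist A n" by simp
    then show ?thesis by (simp add: algebra_simps)
  qed
  show ?thesis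
  proof (rule inv_laplace_eq)
    show "laplace (transverse_mode k c (\<lambda>n. of_real (- q n) * twist A n)) x = transverse_mode k c (twist A) x" for x
      unfolding transverse_mode_laplace[OF dec] eq ..
  qed (intro transverse_mode_smooth transverse_mode_mean_zero dec)+
qed

lemma inv_helmholtz_mode:
  assumes "exp_decaying (twist A)"
  shows "inv_helmholtz (transverse_mode k c (twist A)) = transverse_mode k c (\<lambda>n. of_real (r n) * twist A n)"
proof (rule inv_helmholtz_eq)
  have rb: "norm (complex_of_real (r n)) \<le> 1" for n using r_bounds[of n] by simp
  have dec: "exp_decaying (\<lambda>n. of_real (r n) * twist A n)" by (rule exp_decaying_bounded_mult[OF assms rb])
  show "torus_smooth (transverse_mode k c (\<lambda>n. of_real (r n) * twist A n))" by (rule transverse_mode_smooth[OF dec])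
  fix x
  let ?d = "\<lambda>n. of_real (r n) * twist A n"
  have eq: "?d n + - 1 * (- (1 + (of_int k * of_int n)\<^sup>2) * ?d n) = twist A n" for n
  proof -
    have "2 + (K * of_int n)\<^sup>2 \<noteq> 0" using zero_le_power2[of "K * of_int n"] by linarith
    then have "(2 + (K * of_int n)\<^sup>2) * r n = 1" unfolding r_def by simp
    then have "complex_of_real ((2 + (K * of_int n)\<^sup>2) * r n) = 1" by simp
    then have "(2 + (of_int k * of_int n)\<^sup>2) * complex_of_real (r n) = 1" by (simp add: K_def)
    then have "((2 + (of_int k * of_int n)\<^sup>2) * complex_of_real (r n)) * twist A n = twist A n" by simp
    then show ?thesis by (simp add: algebra_simps)
  qed
  \<comment> \<open>The multiplier \<open>1 + k^2 n^2\<close> is unbounded; the decay is read off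
    from \<open>eq\<close>, which expresses the product as a difference of two decaying
    sequences.\<close>
  have dec': "exp_decaying (\<lambda>n. - (1 + (of_int k * of_int n)\<^sup>2) * ?d n)"
  proof -
    have "exp_decaying (\<lambda>n. twist A n + - 1 * ?d n)"
      by (intro exp_decaying_add exp_decaying_cmult dec assms)
    moreover have "(\<lambda>n. - (1 + (of_int k * of_int n)\<^sup>2) * ?d n) = (\<lambda>n. - 1 * (twist A n + - 1 * ?d n))"
    proof
      have "E = - 1 * (T + - 1 * D)" if "D + - 1 * E = T" for D E T :: complex using that by auto
      from this[OF eq] show "- (1 + (of_int k * of_int n)\<^sup>2) * ?d n = - 1 * (twist A n + - 1 * ?d n)" for n .
    qed
    ultimately show ?thesis by (simp only: exp_decaying_cmult)
  qed
  have "transverse_mode k c ?d x - laplace (transverse_mode k c ?d) x =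
      transverse_mode k c ?d x + transverse_mode k c (\<lambda>n. - 1 * (- (1 + (of_int k * of_int n)\<^sup>2) * ?d n)) x"
    unfolding transverse_mode_laplace[OF dec] transverse_mode_cmult[of k c "- 1"] by simp
  also have "\<dots> = transverse_mode k c (twist A) x"
    unfolding transverse_mode_add[OF dec exp_decaying_cmult[OF dec'], symmetric] eq ..
  finally show "transverse_mode k c ?d x - laplace (transverse_mode k c ?d) x = transverse_mode k c (twist A) x" .
qed

lemma unstable_mode:
  "\<exists>(lam::real) (h :: real \<Rightarrow> complex) (f :: real \<Rightarrow> complex).
     lam > 0 \<and> circle_smooth h \<and> circle_smooth f \<and> (h, f) \<noteq> (\<lambda>_. 0, \<lambda>_. 0) \<and>
     linearized_solution k a
       (\<lambda>t x. of_real (exp (lam * t)) * exp (\<i> * of_real (snd x)) * h (fst x))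
       (\<lambda>t x. of_real (exp (lam * t)) * exp (\<i> * of_real (snd x)) * f (fst x))"
proof -
  obtain l \<sigma> H B F where l: "l > 0" and \<sigma>: "0 < \<sigma>" "\<sigma> < 1"
    and HB: "\<And>n. \<bar>H n\<bar> \<le> B * \<sigma> ^ nat \<bar>n\<bar>" and FB: "\<And>n. \<bar>F n\<bar> \<le> B * \<sigma> ^ nat \<bar>n\<bar>"
    and eqH: "\<And>n. l * H n = K / 2 * (X H F (n + 1) - X H F (n - 1))"
    and eqF: "\<And>n. l * F n = K / 2 * (Y H F (n + 1) - Y H F (n - 1))"
    and nz: "\<exists>n. H n \<noteq> 0"
    using mode_recurrence by metis
  define m where "m = (\<lambda>t. transverse_mode k (of_real (exp (l * t))))"
  have dH: "exp_decaying (twist H)" and dF: "exp_decaying (twist F)"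
    using twist_decaying[OF \<sigma>] HB FB by blast+
  have bounded: "norm (complex_of_real (- q n)) \<le> 1" "norm (complex_of_real (r n)) \<le> 1" for n
    using q_pos[of n] q_le1[of n] r_bounds[of n] by (simp_all add: less_imp_le)
  have dqH: "exp_decaying (\<lambda>n. of_real (- q n) * twist H n)" and drF: "exp_decaying (\<lambda>n. of_real (r n) * twist F n)"
    by (rule exp_decaying_bounded_mult[OF dH bounded(1)], rule exp_decaying_bounded_mult[OF dF bounded(2)])
  \<comment> \<open>\<open>inv_laplace\<close> and \<open>inv_helmholtz\<close> have the symbols
    \<open>- q\<close> and \<open>r\<close>. Written this way, the coefficients match the two
    advected brackets of the linearized system term by term.\<close>
  have tX: "twist (X H F) = (\<lambda>n. (twist H n + of_real (K\<^sup>2) * (of_real (- q n) * twist H n)) +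
      (of_real a * twist F n + of_real (- a * (1 + K\<^sup>2)) * (of_real (r n) * twist F n)))"
    by (simp add: twist_def X_def d1_def d2_def fun_eq_iff algebra_simps)
  have tY: "twist (Y H F) = (\<lambda>n. twist F n + of_real (- (a * (1 + K\<^sup>2))) * (of_real (- q n) * twist H n))"
    by (simp add: twist_def Y_def d3_def fun_eq_iff algebra_simps)
  have dX: "exp_decaying (twist (X H F))" and dY: "exp_decaying (twist (Y H F))"
    unfolding tX tY by (intro exp_decaying_add exp_decaying_cmult dH dF dqH drF)+
  have gX: "(\<lambda>y. (m t (twist H) y + (of_int k)\<^sup>2 *\<^sub>R inv_laplace (m t (twist H)) y)
               + a *\<^sub>R (m t (twist F) y - (1 + (of_int k)\<^sup>2) *\<^sub>R inv_helmholtz (m t (twist F)) y)) = m t (twist (X H F))" for t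
    unfolding tX m_def inv_laplace_mode[OF dH] inv_helmholtz_mode[OF dF]
      transverse_mode_add[OF exp_decaying_add[OF dH exp_decaying_cmult[OF dqH]]
        exp_decaying_add[OF exp_decaying_cmult[OF dF] exp_decaying_cmult[OF drF]]]
      transverse_mode_add[OF dH exp_decaying_cmult[OF dqH]]
      transverse_mode_add[OF exp_decaying_cmult[OF dF] exp_decaying_cmult[OF drF]] transverse_mode_cmult
    by (simp add: scaleR_conv_of_real K_def algebra_simps)
  have gY: "(\<lambda>y. m t (twist F) y - (a * (1 + (of_int k)\<^sup>2)) *\<^sub>R inv_laplace (m t (twist H)) y) = m t (twist (Y H F))" for t
    unfolding tY m_def inv_laplace_mode[OF dH] transverse_mode_add[OF dF exp_decaying_cmult[OF dqH]] transverse_mode_cmult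
    by (simp add: scaleR_conv_of_real K_def)
  have time: "((\<lambda>s. m s d x) has_vector_derivative of_real l * m t d x) (at t)" for d t x
  proof -
    have "((\<lambda>s. exp (l * s)) has_real_derivative l * exp (l * t)) (at t)" by (auto intro!: derivative_eq_intros)
    then have "((\<lambda>s. complex_of_real (exp (l * s))) has_vector_derivative of_real (l * exp (l * t))) (at t)"
      by (intro has_vector_derivative_of_real) (simp add: has_real_derivative_iff_has_vector_derivative)
    from has_vector_derivative_mult_left[OF this, of "exp (\<i> * of_real (snd x)) * fourier_series (of_int k) d (fst x)"]
    show ?thesis unfolding m_def transverse_mode_def by (simp add: mult.assoc)
  qed
  have "linearized_solution k a (\<lambda>t. m t (twist H)) (\<lambda>t. m t (twist F))"
    unfolding linearized_solution_def gX gY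
  proof (intro conjI allI)
    fix t x
    show "torus_smooth (m t (twist H))" "mean_zero (m t (twist H))" "torus_smooth (m t (twist F))"
      unfolding m_def by (intro transverse_mode_smooth transverse_mode_mean_zero dH dF)+
    show "((\<lambda>s. m s (twist H) x) has_vector_derivative - advect (perp_grad (psi_star k)) (m t (twist (X H F))) x) (at t)"
      using time[of "twist H" x t] twist_recurrence[OF dX eqH[unfolded K_def], of "of_real (exp (l * t))" x]
      unfolding m_def shear_advect[OF dX] by simp
    show "((\<lambda>s. m s (twist F) x) has_vector_derivative - advect (perp_grad (psi_star k)) (m t (twist (Y H F))) x) (at t)"
      using time[of "twist F" x t] twist_recurrence[OF dY eqF[unfolded K_def], of "of_real (exp (l * t))" x]
      unfolding m_def shear_advect[OF dY] by simp
  qed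
  moreover have "fourier_series (of_int k) (twist H) \<noteq> (\<lambda>_. 0)"
  proof
    assume "fourier_series (of_int k) (twist H) = (\<lambda>_. 0)"
    then have "twist H n = 0" for n using fourier_series_coeff_zero[OF dH, of k n] k2 by simp
    then show False using nz by (simp add: twist_def)
  qed
  ultimately show ?thesis
    using l fourier_series_smooth[OF dH] fourier_series_smooth[OF dF]
    unfolding m_def transverse_mode_def
    by (intro exI[of _ l] exI[of _ "fourier_series (of_int k) (twist H)"] exI[of _ "fourier_series (of_int k) (twist F)"]) simp
qed

end

theorem theorem2p1:
  fixes k :: int and a :: real
  assumes "k \<ge> 2"
    and "a\<^sup>2 * (1 + (of_int k)\<^sup>2) < 2"
  shows "imhd_steady_state (psi_star k) (Phi_star a k) \<and>
    (\<exists>(lam::real) (h :: real \<Rightarrow> complex) (f :: real \<Rightarrow> complex).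
       lam > 0 \<and> circle_smooth h \<and> circle_smooth f \<and> (h, f) \<noteq> (\<lambda>_. 0, \<lambda>_. 0) \<and>
       linearized_solution k a
         (\<lambda>t x. of_real (exp (lam * t)) * exp (\<i> * of_real (snd x)) * h (fst x))
         (\<lambda>t x. of_real (exp (lam * t)) * exp (\<i> * of_real (snd x)) * f (fst x)))"
proof
  show "imhd_steady_state (psi_star k) (Phi_star a k)" by (rule shear_steady_state)
  interpret imhd k a using assms by unfold_locales
  show "\<exists>(lam::real) (h :: real \<Rightarrow> complex) (f :: real \<Rightarrow> complex).
       lam > 0 \<and> circle_smooth h \<and> circle_smooth f \<and> (h, f) \<noteq> (\<lambda>_. 0, \<lambda>_. 0) \<and>
       linearized_solution k a
         (\<lambda>t x. of_real (exp (lam * t)) * exp (\<i> * of_real (snd x)) * h (fst x))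
         (\<lambda>t x. of_real (exp (lam * t)) * exp (\<i> * of_real (snd x)) * f (fst x))"
    by (rule unstable_mode)
qed

end
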